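(* Let $k \ge 1$ and $m \ge 2$ be integers, and let $m' = \lfloor \log_2(m-1) \rfloor$ and $j = \lceil \log_2(m - 2^{m'}) \rceil$. If $m \le P_{k-1}(Q_{k-1})$, then for all integers $n \ge k$, \[\operatorname{sat}(Q_n, GS_{k,m}) \le \left(k + 1 + m' + \frac{j}{2^{m'}}\right) 2^{n-2}.\]
   Context: $Q_n$ is the $n$-dimensional hypercube: vertex set $\{0,1\}^n$, two vertices adjacent iff they differ in exactly one coordinate. The generalized star $GS_{k,m}$ is the tree consisting of a central vertex and $k$ paths of length $m$ (i.e. with $m$ edges) emanating from it, pairwise sharing only the central vertex. For a hypercube $Q_d$ and integer $t \ge 1$, $P_t(Q_d)$ denotes the maximum integer $\ell$ such that there is a vertex $v$ of $Q_d$ and $t$ paths in $Q_d$, each of length $\ell$ and starting at $v$, which pairwise share no vertex other than $v$. For a graph $G$, a subgraph $H'$ of $Q_n$ is $(Q_n,G)$-saturated if it contains no subgraph isomorphic to $G$ but adding any edge of $Q_n$ not in $H'$ creates a subgraph isomorphic to $G$; $\operatorname{sat}(Q_n,G)$ is the minimum number of edges of such a subgraph. *)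

theory Defs
  imports Complex_Main "HOL-Library.FuncSet"
begin

record 'a ugraph =
  verts :: "'a set"
  edges :: "'a set set"

definition simple_graph :: "'a ugraph \<Rightarrow> bool" where
  "simple_graph G \<longleftrightarrow> edges G \<subseteq> {e. e \<subseteq> verts G \<and> card e = 2}"

text \<open>Subgraphs need not be spanning.\<close>

definition subgraph_of :: "'a ugraph \<Rightarrow> 'a ugraph \<Rightarrow> bool" where
  "subgraph_of H G \<longleftrightarrow>
     simple_graph H \<and> verts H \<subseteq> verts G \<and> edges H \<subseteq> edges G"

definition graph_isomorphic :: "'a ugraph \<Rightarrow> 'b ugraph \<Rightarrow> bool" where
  "graph_isomorphic G H \<longleftrightarrow>
     (\<exists>f. bij_betw f (verts G) (verts H) \<and>
          (\<forall>u\<in>verts G. \<forall>v\<in>verts G. {u, v} \<in> edges G \<longleftrightarrow> {f u, f v} \<in> edges H))"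

definition contains_copy :: "'a ugraph \<Rightarrow> 'b ugraph \<Rightarrow> bool" where
  "contains_copy H G \<longleftrightarrow> (\<exists>S. subgraph_of S H \<and> graph_isomorphic S G)"

text \<open>The endpoints of the new edge are added as well, as they may be missing from a
  non-spanning subgraph.\<close>

definition add_edge :: "'a set \<Rightarrow> 'a ugraph \<Rightarrow> 'a ugraph" where
  "add_edge e H = \<lparr>verts = verts H \<union> e, edges = insert e (edges H)\<rparr>"

definition saturated :: "'a ugraph \<Rightarrow> 'b ugraph \<Rightarrow> 'a ugraph \<Rightarrow> bool" where
  "saturated Q G H \<longleftrightarrow>
     subgraph_of H Q \<and> \<not> contains_copy H G \<and>
     (\<forall>e\<in>edges Q - edges H. contains_copy (add_edge e H) G)"

definition sat_number :: "'a ugraph \<Rightarrow> 'b ugraph \<Rightarrow> nat" where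
  "sat_number Q G = Min {card (edges H) | H. saturated Q G H}"

definition hypercube :: "nat \<Rightarrow> (nat \<Rightarrow> nat) ugraph" where
  "hypercube n =
     \<lparr>verts = {..<n} \<rightarrow>\<^sub>E {0, 1},
      edges = {{x, y} | x y. x \<in> {..<n} \<rightarrow>\<^sub>E {0, 1} \<and> y \<in> {..<n} \<rightarrow>\<^sub>E {0, 1} \<and>
                             card {i. i < n \<and> x i \<noteq> y i} = 1}\<rparr>"

text \<open>The vertex at distance \<open>l\<close> from the centre on the \<open>i\<close>-th leg of a generalized star;
  all legs share the centre \<open>(0, 0)\<close>.\<close>

definition gstar_vertex :: "nat \<Rightarrow> nat \<Rightarrow> nat \<times> nat" where
  "gstar_vertex i l = (if l = 0 then (0, 0) else (i, l))"

definition gstar :: "nat \<Rightarrow> nat \<Rightarrow> (nat \<times> nat) ugraph" where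
  "gstar k m =
     \<lparr>verts = insert (0, 0) {gstar_vertex i l | i l. i < k \<and> l \<le> m},
      edges = {{gstar_vertex i l, gstar_vertex i (Suc l)} | i l. i < k \<and> l < m}\<rparr>"

text \<open>A path is given by the list of its vertices; its length is its number of edges.\<close>

definition is_path :: "'a ugraph \<Rightarrow> 'a list \<Rightarrow> bool" where
  "is_path G p \<longleftrightarrow>
     p \<noteq> [] \<and> set p \<subseteq> verts G \<and> distinct p \<and>
     (\<forall>i. Suc i < length p \<longrightarrow> {p ! i, p ! Suc i} \<in> edges G)"

definition path_length :: "'a list \<Rightarrow> nat" where
  "path_length p = length p - 1"

text \<open>For \<open>t \<ge> 1\<close> the maximum is over a finite nonempty set. For \<open>t = 0\<close> the condition is vacuous
  and there is no maximum; the value is set to \<open>0\<close> by convention.\<close>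

definition max_path_length :: "nat \<Rightarrow> 'a ugraph \<Rightarrow> nat" where
  "max_path_length t G =
     (if t = 0 then 0
      else Max {l. \<exists>v\<in>verts G. \<exists>p :: nat \<Rightarrow> 'a list.
                   (\<forall>i<t. is_path G (p i) \<and> path_length (p i) = l \<and> hd (p i) = v) \<and>
                   (\<forall>i<t. \<forall>j<t. i \<noteq> j \<longrightarrow> set (p i) \<inter> set (p j) = {v})})"

end

theory Submission
  imports Defs
begin

text \<open>Put \<open>d = k - 1\<close> and split \<open>Q\<^sub>n\<close> into subcubes \<open>Q\<^sub>d\<close>, called even or odd by the parity of the
  remaining coordinates. Keep every even subcube complete: each of its vertices has \<open>d\<close> disjoint legs
  of length \<open>m\<close> inside it, so a star appears as soon as a path of length \<open>m\<close> leaves the subcube. On the odd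
  side take a forest of rooted trees of height \<open>h = m - 2\<close>, and join each root by one edge to the even
  side. A path that enters a tree at its root has length at most \<open>m - 1\<close>, so there is no star. Each
  tree has two branches of full height, hence every vertex but the root starts a path of length at
  least \<open>m - 1\<close> in its tree. Therefore each new edge between different trees or between the two sides
  creates a star. So a maximal star-free graph above this one is saturated and only has further
  edges inside the trees' vertex sets. The trees are copies of trees on a subcube \<open>Q\<^sub>r\<close>, so there are few such edges.

  With \<open>m = 2\<^sup>q + 1 + t\<close>, \<open>q = m'\<close>, a single tree on \<open>Q\<^bsub>q+1\<^esub>\<close> suffices for \<open>t = 0\<close> and one on \<open>Q\<^bsub>q+2\<^esub>\<close> for
  \<open>t > 0\<close>; in the latter case \<open>j \<ge> 1\<close> pays for the edge at the root. For \<open>m \<le> 4\<close> these cubes are too small and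
  special trees are used.\<close>

subsection \<open>Hypercubes and embedded copies\<close>

definition cube :: "nat \<Rightarrow> (nat \<Rightarrow> nat) set" where
  "cube n = {..<n} \<rightarrow>\<^sub>E {0, 1}"

text \<open>Values from \<open>r\<close> on stay free, unlike in \<open>cube r\<close>, so that
  functions on an \<open>r\<close>-dimensional tile apply directly to vertices of larger
  cubes.\<close>

definition bits :: "nat \<Rightarrow> (nat \<Rightarrow> nat) \<Rightarrow> bool" where
  "bits r x \<longleftrightarrow> (\<forall>i<r. x i = 0 \<or> x i = 1)"

definition flip :: "nat \<Rightarrow> (nat \<Rightarrow> nat) \<Rightarrow> nat \<Rightarrow> nat" where
  "flip i x = x(i := 1 - x i)"

lemma flip_apply: "flip i x j = (if j = i then 1 - x i else x j)"
  by (simp add: flip_def)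

lemma flip_other [simp]: "j \<noteq> i \<Longrightarrow> flip i x j = x j"
  by (simp add: flip_def)

lemma flip_same [simp]: "flip i x i = 1 - x i"
  by (simp add: flip_def)

lemma bits_flip [intro, simp]: "bits r x \<Longrightarrow> bits r (flip i x)"
  by (auto simp: bits_def flip_apply)

lemma bitsD: "bits r x \<Longrightarrow> i < r \<Longrightarrow> x i = 0 \<or> x i = 1"
  by (simp add: bits_def)

lemma bits_mono: "bits r x \<Longrightarrow> s \<le> r \<Longrightarrow> bits s x"
  by (auto simp: bits_def)

lemma flip_flip [simp]: "bits r x \<Longrightarrow> i < r \<Longrightarrow> flip i (flip i x) = x"
  by (auto simp: bits_def flip_def fun_eq_iff)

lemma flip_neq:
  assumes "bits r x" "i < r"
  shows "flip i x \<noteq> x"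
proof
  assume "flip i x = x"
  then have "flip i x i = x i" by simp
  then show False using bitsD[OF assms] by auto
qed

lemma flip_inject:
  assumes "bits r x" "i < r" "flip i x = flip j x"
  shows "i = j"
proof (rule ccontr)
  assume "i \<noteq> j"
  then have "flip j x i = x i" by simp
  with assms(3) have "flip i x i = x i" by simp
  then show False using bitsD[OF assms(1,2)] by auto
qed

lemma cube_iff: "x \<in> cube n \<longleftrightarrow> bits n x \<and> (\<forall>i\<ge>n. x i = undefined)"
  by (auto simp: cube_def bits_def PiE_iff extensional_def not_less)

lemma cube_bits: "x \<in> cube n \<Longrightarrow> bits n x"
  by (simp add: cube_iff)

lemma flip_cube [simp]: "x \<in> cube n \<Longrightarrow> i < n \<Longrightarrow> flip i x \<in> cube n"
  by (auto simp: cube_iff flip_apply)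

lemma finite_cube [simp]: "finite (cube n)"
  by (simp add: cube_def finite_PiE)

lemma card_cube: "card (cube n) = 2 ^ n"
  by (simp add: cube_def card_PiE numeral_2_eq_2)

lemma verts_hypercube: "verts (hypercube n) = cube n"
  by (simp add: hypercube_def cube_def)

lemma card_diff_eq_1_iff:
  assumes "x \<in> cube n" "y \<in> cube n"
  shows "card {i. i < n \<and> x i \<noteq> y i} = 1 \<longleftrightarrow> (\<exists>i<n. y = flip i x)"
proof
  assume "card {i. i < n \<and> x i \<noteq> y i} = 1"
  then obtain i where i: "{i. i < n \<and> x i \<noteq> y i} = {i}" by (auto simp: card_1_singleton_iff)
  then have "i < n" "x i \<noteq> y i" by auto
  have "y j = flip i x j" for j
  proof (cases "j < n")
    case True
    with i have "j \<noteq> i \<Longrightarrow> x j = y j" by auto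
    moreover have "y i = 1 - x i"
      using bitsD[OF cube_bits[OF assms(1)] \<open>i < n\<close>] bitsD[OF cube_bits[OF assms(2)] \<open>i < n\<close>]
        \<open>x i \<noteq> y i\<close> by auto
    ultimately show ?thesis by (cases "j = i") auto
  next
    case False
    with assms \<open>i < n\<close> show ?thesis by (auto simp: cube_iff)
  qed
  with \<open>i < n\<close> show "\<exists>i<n. y = flip i x" by blast
next
  assume "\<exists>i<n. y = flip i x"
  then obtain i where "i < n" "y = flip i x" by auto
  with assms have "{i. i < n \<and> x i \<noteq> y i} = {i}"
    by (auto simp: cube_iff bits_def flip_apply split: if_splits)
  then show "card {i. i < n \<and> x i \<noteq> y i} = 1" by simp
qed

lemma edges_hypercube: "edges (hypercube n) = {{x, flip i x} | x i. x \<in> cube n \<and> i < n}"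
proof -
  have "edges (hypercube n) = {{x, y} | x y. x \<in> cube n \<and> y \<in> cube n \<and>
      card {i. i < n \<and> x i \<noteq> y i} = 1}"
    by (simp add: hypercube_def cube_def)
  also have "\<dots> = {{x, flip i x} | x i. x \<in> cube n \<and> i < n}" (is "?A = ?B")
  proof (intro equalityI subsetI)
    fix e assume "e \<in> ?A"
    then obtain x y where "e = {x, y}" "x \<in> cube n" "y \<in> cube n"
      "card {i. i < n \<and> x i \<noteq> y i} = 1" by blast
    then show "e \<in> ?B" using card_diff_eq_1_iff by blast
  next
    fix e assume "e \<in> ?B"
    then obtain x i where "e = {x, flip i x}" "x \<in> cube n" "i < n" by blast
    then show "e \<in> ?A" using card_diff_eq_1_iff flip_cube by blast
  qed
  finally show ?thesis .
qed

lemma simple_hypercube: "simple_graph (hypercube n)"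
  unfolding simple_graph_def edges_hypercube verts_hypercube
proof
  fix e assume "e \<in> {{x, flip i x} | x i. x \<in> cube n \<and> i < n}"
  then obtain x i where e: "e = {x, flip i x}" "x \<in> cube n" "i < n" by blast
  then show "e \<in> {e. e \<subseteq> cube n \<and> card e = 2}"
    using flip_neq[OF cube_bits, of x n i] by (simp add: eq_commute)
qed

lemma finite_edges_hypercube: "finite (edges (hypercube n))"
proof -
  have "edges (hypercube n) \<subseteq> Pow (cube n)" by (auto simp: edges_hypercube)
  then show ?thesis by (rule finite_subset) simp
qed

section \<open>Copies of a graph as injective maps, and copies of the star as families of
  legs\<close>

lemma contains_copy_iff:
  assumes "simple_graph G" "simple_graph K"
  shows "contains_copy G K \<longleftrightarrow>
    (\<exists>g. inj_on g (verts K) \<and> g ` verts K \<subseteq> verts G \<and> (\<forall>e\<in>edges K. g ` e \<in> edges G))"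
proof
  assume "contains_copy G K"
  then obtain S f where S: "subgraph_of S G" and f: "bij_betw f (verts S) (verts K)"
    and fe: "\<And>u v. u \<in> verts S \<Longrightarrow> v \<in> verts S \<Longrightarrow> {u, v} \<in> edges S \<longleftrightarrow> {f u, f v} \<in> edges K"
    unfolding contains_copy_def graph_isomorphic_def by blast
  let ?g = "inv_into (verts S) f"
  have g: "bij_betw ?g (verts K) (verts S)" using f by (rule bij_betw_inv_into)
  have "?g ` e \<in> edges G" if "e \<in> edges K" for e
  proof -
    from that assms(2) have "e \<subseteq> verts K" "card e = 2" by (auto simp: simple_graph_def)
    then obtain a b where e: "e = {a, b}" "a \<in> verts K" "b \<in> verts K"
      by (auto simp: card_2_iff)
    have "{?g a, ?g b} \<in> edges S"
      using e that fe[of "?g a" "?g b"] bij_betw_apply[OF g] bij_betw_inv_into_right[OF f] by simp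
    then show ?thesis using S e by (auto simp: subgraph_of_def)
  qed
  moreover have "inj_on ?g (verts K)" "?g ` verts K \<subseteq> verts G"
    using g S by (auto simp: bij_betw_def subgraph_of_def)
  ultimately show "\<exists>g. inj_on g (verts K) \<and> g ` verts K \<subseteq> verts G \<and> (\<forall>e\<in>edges K. g ` e \<in> edges G)"
    by blast
next
  assume "\<exists>g. inj_on g (verts K) \<and> g ` verts K \<subseteq> verts G \<and> (\<forall>e\<in>edges K. g ` e \<in> edges G)"
  then obtain g where g: "inj_on g (verts K)" "g ` verts K \<subseteq> verts G"
    "\<And>e. e \<in> edges K \<Longrightarrow> g ` e \<in> edges G" by blast
  \<comment> \<open>Only the image edges are taken, not all edges of \<open>G\<close> among the
    image vertices; otherwise the subgraph need not be isomorphic to \<open>K\<close>.\<close>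
  let ?S = "\<lparr>verts = g ` verts K, edges = image g ` edges K\<rparr>"
  let ?f = "inv_into (verts K) g"
  have sub: "e \<subseteq> verts K" if "e \<in> edges K" for e
    using that assms(2) by (auto simp: simple_graph_def)
  have "subgraph_of ?S G"
    unfolding subgraph_of_def simple_graph_def
  proof (intro conjI)
    show "edges ?S \<subseteq> {e. e \<subseteq> verts ?S \<and> card e = 2}"
    proof
      fix e assume "e \<in> edges ?S"
      then obtain e' where e': "e = g ` e'" "e' \<in> edges K" by auto
      then have "card e = card e'" using card_image[OF inj_on_subset[OF g(1) sub]] by simp
      then show "e \<in> {e. e \<subseteq> verts ?S \<and> card e = 2}"
        using e' sub[OF e'(2)] assms(2) by (auto simp: simple_graph_def)
    qed
  qed (use g in auto)
  moreover have "graph_isomorphic ?S K"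
    unfolding graph_isomorphic_def
  proof (intro exI conjI ballI)
    show "bij_betw ?f (verts ?S) (verts K)"
      using g(1) by (simp add: bij_betw_inv_into inj_on_imp_bij_betw)
    fix u v assume "u \<in> verts ?S" "v \<in> verts ?S"
    then obtain a b where ab: "u = g a" "v = g b" "a \<in> verts K" "b \<in> verts K" by auto
    have "{u, v} \<in> edges ?S \<longleftrightarrow> g ` {a, b} \<in> image g ` edges K" using ab by simp
    also have "\<dots> \<longleftrightarrow> {a, b} \<in> edges K"
    proof
      assume "g ` {a, b} \<in> image g ` edges K"
      then obtain e where e: "g ` {a, b} = g ` e" "e \<in> edges K" by auto
      then have "{a, b} = e" using inj_on_image_eq_iff[OF g(1), of "{a, b}" e] sub[of e] ab by simp
      with e show "{a, b} \<in> edges K" by simp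
    qed (rule imageI)
    finally show "{u, v} \<in> edges ?S \<longleftrightarrow> {?f u, ?f v} \<in> edges K"
      using ab g(1) by simp
  qed
  ultimately show "contains_copy G K" unfolding contains_copy_def by blast
qed

lemma contains_copy_mono:
  assumes "contains_copy G K" "simple_graph G" "simple_graph G'" "simple_graph K"
    and "verts G \<subseteq> verts G'" "edges G \<subseteq> edges G'"
  shows "contains_copy G' K"
proof -
  obtain g where "inj_on g (verts K)" "g ` verts K \<subseteq> verts G" "\<forall>e\<in>edges K. g ` e \<in> edges G"
    using assms(1) unfolding contains_copy_iff[OF assms(2,4)] by (elim exE conjE)
  then show ?thesis
    unfolding contains_copy_iff[OF assms(3,4)] using assms(5,6) by (intro exI[of _ g]) auto
qed

lemma verts_gstar: "0 < k \<Longrightarrow> verts (gstar k m) = {gstar_vertex i l | i l. i < k \<and> l \<le> m}"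
  by (force simp: gstar_def gstar_vertex_def)

lemma edges_gstar:
  "edges (gstar k m) = {{gstar_vertex i l, gstar_vertex i (Suc l)} | i l. i < k \<and> l < m}"
  by (simp add: gstar_def)

lemma simple_gstar: "simple_graph (gstar k m)"
proof -
  have "gstar_vertex i l \<noteq> gstar_vertex i (Suc l)" for i l by (simp add: gstar_vertex_def)
  then have "card {gstar_vertex i l, gstar_vertex i (Suc l)} = 2" for i l by simp
  moreover have "{gstar_vertex i l, gstar_vertex i (Suc l)} \<subseteq> verts (gstar k m)" if "i < k" "l < m" for i l
  proof -
    have "gstar_vertex i a \<in> verts (gstar k m)" if "a \<le> m" for a
      using that \<open>i < k\<close> verts_gstar[of k m] by blast
    then show ?thesis using \<open>l < m\<close> by simp
  qed
  ultimately show ?thesis unfolding simple_graph_def edges_gstar by auto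
qed

text \<open>The leg index is irrelevant at the centre, hence \<open>gstar_vertex\<close> in the injectivity condition.\<close>

lemma contains_gstar_iff:
  assumes "simple_graph G" "0 < k" "0 < m"
  shows "contains_copy G (gstar k m) \<longleftrightarrow>
    (\<exists>L c. (\<forall>i<k. L i 0 = c) \<and> (\<forall>i<k. \<forall>l<m. {L i l, L i (Suc l)} \<in> edges G) \<and>
      (\<forall>i<k. \<forall>j<k. \<forall>l\<le>m. \<forall>l'\<le>m. L i l = L j l' \<longrightarrow> gstar_vertex i l = gstar_vertex j l'))"
    (is "_ = ?R")
proof
  assume "contains_copy G (gstar k m)"
  then obtain g where g: "inj_on g (verts (gstar k m))"
    "\<And>e. e \<in> edges (gstar k m) \<Longrightarrow> g ` e \<in> edges G"
    unfolding contains_copy_iff[OF assms(1) simple_gstar] by blast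
  let ?L = "\<lambda>i l. g (gstar_vertex i l)"
  have "?L i 0 = g (0, 0)" for i by (simp add: gstar_vertex_def)
  moreover have "{?L i l, ?L i (Suc l)} \<in> edges G" if "i < k" "l < m" for i l
    using g(2)[of "{gstar_vertex i l, gstar_vertex i (Suc l)}"] that by (auto simp: edges_gstar)
  moreover have "gstar_vertex i l = gstar_vertex j l'"
    if "i < k" "j < k" "l \<le> m" "l' \<le> m" "?L i l = ?L j l'" for i j l l'
  proof -
    have "gstar_vertex i l \<in> verts (gstar k m)" "gstar_vertex j l' \<in> verts (gstar k m)"
      using that unfolding verts_gstar[OF assms(2)] by blast+
    then show ?thesis using that(5) inj_onD[OF g(1)] by simp
  qed
  ultimately show ?R by (intro exI[of _ ?L] exI[of _ "g (0, 0)"]) simp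
next
  assume ?R
  then obtain L c where *: "\<forall>i<k. L i 0 = c" "\<forall>i<k. \<forall>l<m. {L i l, L i (Suc l)} \<in> edges G"
      "\<forall>i<k. \<forall>j<k. \<forall>l\<le>m. \<forall>l'\<le>m. L i l = L j l' \<longrightarrow> gstar_vertex i l = gstar_vertex j l'"
    by (elim exE conjE)
  have L0: "L i 0 = c" if "i < k" for i using *(1) that by simp
  have Le: "{L i l, L i (Suc l)} \<in> edges G" if "i < k" "l < m" for i l using *(2) that by simp
  have Li: "gstar_vertex i l = gstar_vertex j l'"
    if "i < k" "j < k" "l \<le> m" "l' \<le> m" "L i l = L j l'" for i j l l' using *(3) that by blast
  let ?g = "\<lambda>(i, l). L i l"
  have g: "?g (gstar_vertex i l) = L i l" if "i < k" for i l
    using that assms(2) L0 by (simp add: gstar_vertex_def)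
  \<comment> \<open>As \<open>m\<close> is positive, every vertex of a leg lies on one of its edges,
    which is why the criterion needs no membership condition.\<close>
  have V: "L i l \<in> verts G" if "i < k" "l \<le> m" for i l
  proof -
    have *: "u \<in> verts G \<and> v \<in> verts G" if "{u, v} \<in> edges G" for u v
      using that assms(1) by (auto simp: simple_graph_def)
    show ?thesis
    proof (cases l)
      case 0
      then show ?thesis using *[OF Le[of i 0]] that assms(3) by simp
    next
      case (Suc l')
      then show ?thesis using *[OF Le[of i l']] that by simp
    qed
  qed
  have "inj_on ?g (verts (gstar k m))"
  proof (rule inj_onI)
    fix u v assume uv: "u \<in> verts (gstar k m)" "v \<in> verts (gstar k m)" "?g u = ?g v"
    then obtain i l j l' where *: "u = gstar_vertex i l" "v = gstar_vertex j l'"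
      "i < k" "j < k" "l \<le> m" "l' \<le> m" unfolding verts_gstar[OF assms(2)] by blast
    with uv(3) have "L i l = L j l'" using g by simp
    from Li[OF *(3-) this] show "u = v" unfolding * .
  qed
  moreover have "?g ` verts (gstar k m) \<subseteq> verts G"
  proof
    fix w assume "w \<in> ?g ` verts (gstar k m)"
    then obtain i l where "w = ?g (gstar_vertex i l)" "i < k" "l \<le> m"
      unfolding verts_gstar[OF assms(2)] by blast
    then show "w \<in> verts G" using g V by simp
  qed
  moreover have "?g ` e \<in> edges G" if "e \<in> edges (gstar k m)" for e
  proof -
    obtain i l where "e = {gstar_vertex i l, gstar_vertex i (Suc l)}" "i < k" "l < m"
      using \<open>e \<in> _\<close> unfolding edges_gstar by blast
    then show ?thesis using g Le by simp
  qed
  ultimately show "contains_copy G (gstar k m)"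
    unfolding contains_copy_iff[OF assms(1) simple_gstar]
    by (intro exI[of _ ?g] conjI ballI)
qed

subsection \<open>Sides of the cube and legs\<close>

definition odd_side :: "nat \<Rightarrow> nat \<Rightarrow> (nat \<Rightarrow> nat) set" where
  "odd_side d n = {x \<in> cube n. odd (\<Sum>i\<in>{d..<n}. x i)}"

definition even_side :: "nat \<Rightarrow> nat \<Rightarrow> (nat \<Rightarrow> nat) set" where
  "even_side d n = cube n - odd_side d n"

lemma flip_odd_side_low: "i < d \<Longrightarrow> x \<in> odd_side d n \<Longrightarrow> d \<le> n \<Longrightarrow> flip i x \<in> odd_side d n"
  by (auto simp: odd_side_def)

lemma odd_sum_flip:
  assumes "x \<in> cube n" "d \<le> i" "i < n"
  shows "odd (\<Sum>j\<in>{d..<n}. flip i x j) \<longleftrightarrow> even (\<Sum>j\<in>{d..<n}. x j)"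
proof -
  have "(\<Sum>j\<in>{d..<n}. f j) = f i + (\<Sum>j\<in>{d..<n} - {i}. f j)" for f :: "nat \<Rightarrow> nat"
    using assms by (subst sum.remove[of _ i]) auto
  from this[of x] this[of "flip i x"] show ?thesis
    using bitsD[OF cube_bits[OF assms(1)] assms(3)] by auto
qed

lemma flip_odd_side_high: "d \<le> i \<Longrightarrow> i < n \<Longrightarrow> x \<in> odd_side d n \<Longrightarrow> flip i x \<in> even_side d n"
  by (auto simp: odd_side_def even_side_def odd_sum_flip)

lemma flip_even_side_high: "d \<le> i \<Longrightarrow> i < n \<Longrightarrow> x \<in> even_side d n \<Longrightarrow> flip i x \<in> odd_side d n"
  by (auto simp: odd_side_def even_side_def odd_sum_flip)

lemma flip_even_side_low: "i < d \<Longrightarrow> x \<in> even_side d n \<Longrightarrow> d \<le> n \<Longrightarrow> flip i x \<in> even_side d n"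
  by (auto simp: odd_side_def even_side_def)

text \<open>Flipping coordinate \<open>d\<close>, one of those that enter the parity, is a bijection
  between the sides.\<close>

lemma card_sides:
  assumes "d < n"
  shows "card (odd_side d n) = 2 ^ (n - 1)" "card (even_side d n) = 2 ^ (n - 1)"
proof -
  have fin: "finite (odd_side d n)" "finite (even_side d n)"
    by (auto simp: odd_side_def even_side_def)
  have "bij_betw (flip d) (odd_side d n) (even_side d n)"
  proof (rule bij_betwI[of _ _ _ "flip d"])
    show "flip d \<in> odd_side d n \<rightarrow> even_side d n" using assms by (auto intro: flip_odd_side_high)
    show "flip d \<in> even_side d n \<rightarrow> odd_side d n" using assms by (auto intro: flip_even_side_high)
  qed (use assms in \<open>auto simp: odd_side_def even_side_def intro!: flip_flip[OF cube_bits]\<close>)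
  then have eq: "card (odd_side d n) = card (even_side d n)" by (rule bij_betw_same_card)
  have "card (odd_side d n) + card (even_side d n) = card (cube n)"
    using fin by (subst card_Un_disjoint[symmetric])
      (auto simp: even_side_def odd_side_def intro!: arg_cong[where f = card])
  moreover have "(2::nat) ^ n = 2 * 2 ^ (n - 1)" using assms by (cases n) auto
  ultimately show "card (odd_side d n) = 2 ^ (n - 1)" "card (even_side d n) = 2 ^ (n - 1)"
    using eq by (simp_all add: card_cube)
qed

section \<open>Disjoint legs inside a subcube\<close>

definition legs_from :: "nat \<Rightarrow> nat \<Rightarrow> nat \<Rightarrow> (nat \<Rightarrow> nat) \<Rightarrow> (nat \<Rightarrow> nat \<Rightarrow> nat \<Rightarrow> nat) \<Rightarrow> bool" where
  "legs_from d n m x L \<longleftrightarrow>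
     (\<forall>i<d. L i 0 = x) \<and>
     (\<forall>i<d. \<forall>l\<le>m. L i l \<in> cube n \<and> (\<forall>j\<ge>d. L i l j = x j)) \<and>
     (\<forall>i<d. \<forall>l<m. \<exists>j<d. L i (Suc l) = flip j (L i l)) \<and>
     (\<forall>i<d. \<forall>i'<d. \<forall>l\<le>m. \<forall>l'\<le>m. L i l = L i' l' \<longrightarrow> gstar_vertex i l = gstar_vertex i' l')"

lemma legs_fromD:
  assumes "legs_from d n m x L" "i < d"
  shows "L i 0 = x"
    and "l \<le> m \<Longrightarrow> L i l \<in> cube n"
    and "l \<le> m \<Longrightarrow> d \<le> j \<Longrightarrow> L i l j = x j"
    and "l < m \<Longrightarrow> \<exists>j<d. L i (Suc l) = flip j (L i l)"
  using assms by (simp_all add: legs_from_def)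

lemma legs_from_inj:
  assumes "legs_from d n m x L" "L i l = L i' l'" "i < d" "i' < d" "l \<le> m" "l' \<le> m"
  shows "gstar_vertex i l = gstar_vertex i' l'"
proof -
  have "\<forall>i<d. \<forall>i'<d. \<forall>l\<le>m. \<forall>l'\<le>m. L i l = L i' l' \<longrightarrow> gstar_vertex i l = gstar_vertex i' l'"
    using assms(1) unfolding legs_from_def by (elim conjE)
  from this[rule_format, OF assms(3-6,2)] show ?thesis .
qed

text \<open>The maximum is attained, because lengths are bounded by the number of vertices and
  trivial paths are available. Its paths are cut after \<open>m\<close> steps.\<close>

lemma max_path_length_legs:
  assumes "m \<le> max_path_length d (hypercube d)" "0 < d"
  obtains v L where "v \<in> cube d" "legs_from d d m v L"
proof -
  let ?P = "\<lambda>l v p. (\<forall>i<d. is_path (hypercube d) (p i) \<and> path_length (p i) = l \<and> hd (p i) = v) \<and>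
      (\<forall>i<d. \<forall>j<d. i \<noteq> j \<longrightarrow> set (p i) \<inter> set (p j) = {v})"
  let ?S = "{l. \<exists>v\<in>verts (hypercube d). \<exists>p :: nat \<Rightarrow> (nat \<Rightarrow> nat) list. ?P l v p}"
  have "l \<le> 2 ^ d" if "l \<in> ?S" for l
  proof -
    from that obtain v p where vp: "?P l v p" by blast
    then have "is_path (hypercube d) (p 0)" and l: "path_length (p 0) = l"
      using assms(2) by simp_all
    then have "distinct (p 0)" "set (p 0) \<subseteq> cube d" by (auto simp: is_path_def verts_hypercube)
    then have "length (p 0) \<le> card (cube d)"
      by (metis card_mono distinct_card finite_cube)
    then show ?thesis using l by (simp add: path_length_def card_cube)
  qed
  then have "?S \<subseteq> {..2 ^ d}" by (intro subsetI) (simp only: atMost_iff)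
  then have fin: "finite ?S" by (rule finite_subset) simp
  have "(\<lambda>i. if i < d then 0 else undefined) \<in> cube d" by (auto simp: cube_iff bits_def)
  then have "0 \<in> ?S"
    by (intro CollectI bexI[where x = "\<lambda>i. if i < d then 0 else undefined"]
        exI[of _ "\<lambda>_. [\<lambda>i. if i < d then 0 else undefined]"])
      (auto simp: is_path_def path_length_def verts_hypercube)
  then have "?S \<noteq> {}" by (intro notI) (simp only: empty_iff)
  with fin have "Max ?S \<in> ?S" by (rule Max_in)
  moreover have "m \<le> Max ?S" using assms by (simp add: max_path_length_def)
  ultimately obtain l where l: "l \<in> ?S" "m \<le> l" by (rule that)
  from l(1) obtain v p where v: "v \<in> cube d" and P: "?P l v p"
    unfolding mem_Collect_eq verts_hypercube by (elim bexE exE)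
  have path: "distinct (p i)" "length (p i) = Suc l" "hd (p i) = v" "p i \<noteq> []"
    "set (p i) \<subseteq> cube d" "\<And>q. Suc q < length (p i) \<Longrightarrow> {p i ! q, p i ! Suc q} \<in> edges (hypercube d)"
    if "i < d" for i
    using P that by (auto simp: is_path_def path_length_def verts_hypercube)
  have "legs_from d d m v (\<lambda>i q. p i ! q)"
    unfolding legs_from_def
  proof (intro conjI allI impI)
    fix i assume i: "i < d"
    then show "p i ! 0 = v" using path(3,4)[OF i] by (simp add: hd_conv_nth)
    fix q assume "q \<le> m"
    then show in_cube: "p i ! q \<in> cube d"
      using path(2,5)[OF i] \<open>m \<le> l\<close> by (metis le_imp_less_Suc le_trans nth_mem subsetD)
    fix j assume "d \<le> j"
    then show "(p i ! q) j = v j" using in_cube v by (simp add: cube_iff)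
  next
    fix i q assume i: "i < d" and "q < m"
    then have "{p i ! q, p i ! Suc q} \<in> edges (hypercube d)"
      using path(2,6)[OF i] \<open>m \<le> l\<close> by simp
    then obtain x j where x: "{p i ! q, p i ! Suc q} = {x, flip j x}" "x \<in> cube d" "j < d"
      by (auto simp: edges_hypercube)
    then have "p i ! Suc q = flip j (p i ! q)"
      using flip_flip[OF cube_bits[OF x(2)] x(3)] by (auto simp: doubleton_eq_iff)
    then show "\<exists>j<d. p i ! Suc q = flip j (p i ! q)" using x(3) by blast
  next
    fix i i' q q' assume *: "i < d" "i' < d" "q \<le> m" "q' \<le> m" "p i ! q = p i' ! q'"
    have len: "q < length (p i)" "q' < length (p i')"
      using path(2)[OF *(1)] path(2)[OF *(2)] * \<open>m \<le> l\<close> by auto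
    show "gstar_vertex i q = gstar_vertex i' q'"
    proof (cases "i = i'")
      case True
      then show ?thesis using len *(5) path(1)[OF *(1)] by (simp add: nth_eq_iff_index_eq)
    next
      case False
      \<comment> \<open>Different paths meet only in \<open>v\<close>, and each visits
        \<open>v\<close> only at its start, so both positions are 0.\<close>
      then have "p i ! q = v"
        using P * len nth_mem[OF len(1)] nth_mem[OF len(2)] by (metis IntI singletonD)
      then have "p i ! q = p i ! 0" "p i' ! q' = p i' ! 0"
        using *(5) path(3,4)[OF *(1)] path(3,4)[OF *(2)] by (simp_all add: hd_conv_nth)
      moreover have "0 < length (p i)" "0 < length (p i')" using len by linarith+
      ultimately have "q = 0" "q' = 0"
        using nth_eq_iff_index_eq[OF path(1)[OF *(1)] len(1), of 0]
          nth_eq_iff_index_eq[OF path(1)[OF *(2)] len(2), of 0] by simp_all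
      then show ?thesis by (simp add: gstar_vertex_def)
    qed
  qed
  with v that show thesis by blast
qed

text \<open>The \<open>d * m\<close> vertices of the legs other than the centre are distinct and
  differ from \<open>v\<close>. The inequality later ensures that the tiles fit into
  \<open>Q_d\<close>.\<close>

lemma legs_card:
  assumes "legs_from d d m v L" "v \<in> cube d" "0 < d"
  shows "d * m < 2 ^ d"
proof -
  let ?f = "\<lambda>(i, l). L i (Suc l)"
  note L = legs_fromD(2)[OF assms(1)] and Li = legs_from_inj[OF assms(1)]
  have L0: "L 0 0 = v" by (rule legs_fromD(1)[OF assms(1,3)])
  have "inj_on ?f ({..<d} \<times> {..<m})"
  proof (rule inj_onI)
    fix a b assume "a \<in> {..<d} \<times> {..<m}" "b \<in> {..<d} \<times> {..<m}" "?f a = ?f b"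
    then have "gstar_vertex (fst a) (Suc (snd a)) = gstar_vertex (fst b) (Suc (snd b))"
      by (intro Li) auto
    then show "a = b" by (simp add: gstar_vertex_def prod_eq_iff)
  qed
  moreover have "?f ` ({..<d} \<times> {..<m}) \<subseteq> cube d - {v}"
  proof
    fix w assume "w \<in> ?f ` ({..<d} \<times> {..<m})"
    then obtain i l where il: "i < d" "l < m" and w: "w = L i (Suc l)" by auto
    then have "w \<in> cube d" using L by simp
    moreover have "w \<noteq> v"
    proof
      assume "w = v"
      then have "gstar_vertex i (Suc l) = gstar_vertex 0 0" using il assms(3) L0 w Li[of i "Suc l" 0 0] by simp
      then show False by (simp add: gstar_vertex_def)
    qed
    ultimately show "w \<in> cube d - {v}" by simp
  qed
  ultimately have "card ({..<d} \<times> {..<m}) \<le> card (cube d - {v})" by (intro card_inj_on_le) auto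
  also have "\<dots> < card (cube d)" using assms(2) by (intro psubset_card_mono) auto
  finally show ?thesis by (simp add: card_cube card_cartesian_product)
qed

text \<open>Legs at one vertex are carried to any other vertex by a translation of \<open>\<int>\<^sub>2\<^sup>n\<close>.\<close>

lemma legs_translate:
  assumes L: "legs_from d d m v L" and v: "v \<in> cube d" and x: "x \<in> cube n" and "d \<le> n"
  shows "\<exists>L'. legs_from d n m x L'"
proof -
  \<comment> \<open>On the first \<open>d\<close> coordinates this adds \<open>v + x\<close> modulo
    2; the other coordinates are those of \<open>x\<close>.\<close>
  define tr where "tr w i = (if i < d then (if w i = v i then x i else 1 - x i) else x i)" for w i
  have xb: "x i = 0 \<or> x i = 1" if "i < d" for i using x that \<open>d \<le> n\<close> by (auto simp: cube_iff bits_def)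
  have tr_cube: "tr w \<in> cube n" for w
    using x \<open>d \<le> n\<close> by (auto simp: tr_def cube_iff bits_def)
  have tr_inj: "w = w'" if w: "w \<in> cube d" "w' \<in> cube d" "tr w = tr w'" for w w'
  proof
    fix i show "w i = w' i"
    proof (cases "i < d")
      case True
      then show ?thesis
        using fun_cong[OF w(3), of i] xb[OF True] bitsD[OF cube_bits[OF w(1)] True]
          bitsD[OF cube_bits[OF w(2)] True] bitsD[OF cube_bits[OF v] True]
        by (auto simp: tr_def split: if_splits)
    next
      case False
      then show ?thesis using w by (simp add: cube_iff)
    qed
  qed
  have tr_flip: "tr (flip j w) = flip j (tr w)" if "w \<in> cube d" "j < d" for j w
  proof
    fix i show "tr (flip j w) i = flip j (tr w) i"
      using xb[OF that(2)] bitsD[OF cube_bits[OF that(1)] that(2)] bitsD[OF cube_bits[OF v] that(2)] that(2)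
      by (cases "i = j") (auto simp: tr_def)
  qed
  have "legs_from d n m x (\<lambda>i l. tr (L i l))"
    unfolding legs_from_def
  proof (intro conjI allI impI)
    fix i assume "i < d"
    then show "tr (L i 0) = x" using legs_fromD(1)[OF L] by (auto simp: tr_def)
  next
    fix i l j assume "d \<le> j"
    then show "tr (L i l) j = x j" by (simp add: tr_def)
  next
    fix i l assume "i < d" "l < m"
    then obtain j where "j < d" "L i (Suc l) = flip j (L i l)" "L i l \<in> cube d"
      using legs_fromD(2,4)[OF L, of i l] by auto
    then show "\<exists>j<d. tr (L i (Suc l)) = flip j (tr (L i l))" using tr_flip by auto
  next
    fix i i' l l' assume *: "i < d" "i' < d" "l \<le> m" "l' \<le> m" "tr (L i l) = tr (L i' l')"
    have "L i l = L i' l'"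
      by (rule tr_inj[OF legs_fromD(2)[OF L *(1,3)] legs_fromD(2)[OF L *(2,4)] *(5)])
    then show "gstar_vertex i l = gstar_vertex i' l'" by (rule legs_from_inj[OF L _ *(1-4)])
  qed (rule tr_cube)
  then show ?thesis by blast
qed

subsection \<open>Graphs built from a rooted tile\<close>

definition par :: "((nat \<Rightarrow> nat) \<Rightarrow> nat) \<Rightarrow> (nat \<Rightarrow> nat) \<Rightarrow> nat \<Rightarrow> nat" where
  "par D x = flip (D x) x"

text \<open>A forest of height \<open>h\<close> on \<open>Q_r\<close>, where \<open>D x\<close> is
  the coordinate flipped to reach the parent and \<open>pt\<close> is a marking constant on each
  tree. By \<open>local\<close> the tile can be repeated in every subcube. By \<open>arms\<close>
  each root has two branches of full height in its own copy of the tile, starting with different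
  children, so one of them avoids any given branch.\<close>

locale rooted_tile =
  fixes r h :: nat and D dep :: "(nat \<Rightarrow> nat) \<Rightarrow> nat" and pt :: "(nat \<Rightarrow> nat) \<Rightarrow> bool"
  assumes local: "(\<And>i. i < r \<Longrightarrow> x i = y i) \<Longrightarrow> dep x = dep y \<and> D x = D y \<and> pt x = pt y"
    and D_less: "bits r x \<Longrightarrow> 0 < dep x \<Longrightarrow> D x < r"
    and dep_par: "bits r x \<Longrightarrow> 0 < dep x \<Longrightarrow> Suc (dep (par D x)) = dep x"
    and pt_par: "bits r x \<Longrightarrow> 0 < dep x \<Longrightarrow> pt (par D x) = pt x"
    and dep_le: "bits r x \<Longrightarrow> dep x \<le> h"
    and arms: "bits r x \<Longrightarrow> dep x = 0 \<Longrightarrow> \<exists>z z'. bits r z \<and> bits r z' \<and>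
      (\<forall>i\<ge>r. z i = x i \<and> z' i = x i) \<and> dep z = h \<and> dep z' = h \<and>
      (par D ^^ h) z = x \<and> (par D ^^ h) z' = x \<and>
      (0 < h \<longrightarrow> (par D ^^ (h - 1)) z \<noteq> (par D ^^ (h - 1)) z')"

text \<open>The legs of the star have length \<open>h + 2\<close>, and \<open>r \<le> d\<close> puts
  each copy of the tile inside one subcube \<open>Q_d\<close>.\<close>

locale saturating = rooted_tile +
  fixes n d :: nat
  assumes rd: "r \<le> d" and dn: "d < n" and d0: "0 < d"
    and legs: "x \<in> cube n \<Longrightarrow> \<exists>L. legs_from d n (h + 2) x L"
begin

definition "even_edges = {{x, flip i x} | x i. x \<in> even_side d n \<and> i < d}"

definition "up u = (if dep u = 0 then flip d u else par D u)"

definition "base_edges = even_edges \<union> {{u, up u} | u. u \<in> odd_side d n}"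

definition "allowed_edges = even_edges \<union> {{u, flip d u} | u. u \<in> odd_side d n \<and> dep u = 0}
  \<union> {{u, flip i u} | u i. u \<in> odd_side d n \<and> i < r \<and> pt (flip i u) = pt u}"

definition "spanning F = \<lparr>verts = cube n, edges = F\<rparr>"

abbreviation "star \<equiv> gstar (Suc d) (h + 2)"

abbreviation "chain F \<equiv> successively (\<lambda>u v. {u, v} \<in> F)"

lemma odd_cube: "x \<in> odd_side d n \<Longrightarrow> x \<in> cube n"
  by (simp add: odd_side_def)

lemma even_cube: "x \<in> even_side d n \<Longrightarrow> x \<in> cube n"
  by (simp add: even_side_def)

lemma odd_not_even: "x \<in> odd_side d n \<Longrightarrow> x \<notin> even_side d n"
  by (simp add: even_side_def)

lemma cube_bits_r: "x \<in> cube n \<Longrightarrow> bits r x"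
  using rd dn by (intro bits_mono[OF cube_bits[of x n]]) auto

lemma odd_bits: "x \<in> odd_side d n \<Longrightarrow> bits r x"
  by (intro cube_bits_r odd_cube)

lemma sides_differ:
  assumes "x \<in> even_side d n" "y \<in> odd_side d n"
  shows "\<exists>j\<ge>d. y j \<noteq> x j"
proof (rule ccontr)
  assume "\<not> (\<exists>j\<ge>d. y j \<noteq> x j)"
  then have "(\<Sum>j\<in>{d..<n}. y j) = (\<Sum>j\<in>{d..<n}. x j)" by (intro sum.cong) auto
  with assms show False by (auto simp: even_side_def odd_side_def)
qed

lemma par_odd:
  assumes "x \<in> odd_side d n" "0 < dep x"
  shows "par D x \<in> odd_side d n"
  unfolding par_def using D_less[OF odd_bits[OF assms(1)] assms(2)] rd dn assms
  by (intro flip_odd_side_low) auto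

section \<open>The base graph and the absence of stars in it\<close>

lemma spanning_simple:
  assumes "F \<subseteq> edges (hypercube n)"
  shows "simple_graph (spanning F)"
  using assms simple_hypercube[of n]
  by (auto simp: simple_graph_def spanning_def verts_hypercube)

lemma contains_star_iff:
  assumes "F \<subseteq> edges (hypercube n)"
  shows "contains_copy (spanning F) star \<longleftrightarrow>
    (\<exists>L c. (\<forall>i<Suc d. L i 0 = c) \<and> (\<forall>i<Suc d. \<forall>l<h + 2. {L i l, L i (Suc l)} \<in> F) \<and>
      (\<forall>i<Suc d. \<forall>j<Suc d. \<forall>l\<le>h + 2. \<forall>l'\<le>h + 2.
        L i l = L j l' \<longrightarrow> gstar_vertex i l = gstar_vertex j l'))"
proof -
  have "edges (spanning F) = F" by (simp add: spanning_def)
  moreover have "0 < Suc d" "0 < h + 2" by simp_all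
  ultimately show ?thesis
    using contains_gstar_iff[OF spanning_simple[OF assms], of "Suc d" "h + 2"] by (simp only:)
qed

lemma even_edges_hypercube: "even_edges \<subseteq> edges (hypercube n)"
  using dn by (fastforce simp: even_edges_def edges_hypercube even_side_def)

lemma base_edges_hypercube: "base_edges \<subseteq> edges (hypercube n)"
proof
  fix e assume "e \<in> base_edges"
  then consider "e \<in> even_edges" | u where "u \<in> odd_side d n" "e = {u, up u}"
    by (auto simp: base_edges_def)
  then show "e \<in> edges (hypercube n)"
  proof cases
    case 2
    define i where "i = (if dep u = 0 then d else D u)"
    have "i < n" using D_less[OF odd_bits[OF 2(1)]] rd dn by (auto simp: i_def)
    moreover have "up u = flip i u" by (simp add: up_def i_def par_def)
    ultimately show ?thesis using 2 odd_cube by (auto simp: edges_hypercube)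
  qed (use even_edges_hypercube in auto)
qed

text \<open>A leg that leaves a vertex downwards, away from the root of its tree or from the even side, can
  only keep descending, so it is shorter than \<open>h + 2\<close>.\<close>

lemma no_descending_leg:
  assumes e: "\<And>l. l < h + 2 \<Longrightarrow> {w l, w (Suc l)} \<in> base_edges"
    and ne: "\<And>l. Suc l < h + 2 \<Longrightarrow> w (Suc (Suc l)) \<noteq> w l"
    and w1: "w 1 \<in> odd_side d n" "up (w 1) = w 0"
  shows False
proof -
  have "w (Suc l) \<in> odd_side d n \<and> up (w (Suc l)) = w l \<and> l \<le> dep (w (Suc l))" if "l < h + 2" for l
    using that
  proof (induction l)
    case 0
    then show ?case using w1 by simp
  next
    case (Suc l)
    let ?a = "w (Suc l)" and ?b = "w (Suc (Suc l))"
    have IH: "?a \<in> odd_side d n" "up ?a = w l" "l \<le> dep ?a" using Suc by auto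
    have "{?a, ?b} \<notin> even_edges"
      using IH(1) odd_not_even flip_even_side_low dn by (force simp: even_edges_def doubleton_eq_iff)
    then obtain u where u: "u \<in> odd_side d n" "{?a, ?b} = {u, up u}"
      using e[OF Suc.prems] by (auto simp: base_edges_def)
    \<comment> \<open>The upward edge of \<open>w (Suc l)\<close> leads back to \<open>w l\<close>,
      so the present edge is the upward edge of the next vertex, which is a child.\<close>
    have "\<not> (u = ?a \<and> up u = ?b)" using IH(2) ne[of l] Suc.prems by auto
    with u(2) have ub: "u = ?b" "up u = ?a" by (auto simp: doubleton_eq_iff)
    have "dep u \<noteq> 0"
    proof
      assume "dep u = 0"
      then have "?a \<in> even_side d n" using ub u(1) dn flip_odd_side_high[of d d n u] by (simp add: up_def)
      then show False using IH(1) odd_not_even by blast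
    qed
    then have "Suc (dep ?a) = dep u" using ub dep_par[OF odd_bits[OF u(1)]] by (simp add: up_def)
    then show ?case using u ub IH(3) by simp
  qed
  \<comment> \<open>The vertex after \<open>h + 2\<close> steps would have depth at least
    \<open>h + 1\<close>, beyond the height.\<close>
  from this[of "Suc h"] have "w (Suc (Suc h)) \<in> odd_side d n" "Suc h \<le> dep (w (Suc (Suc h)))" by simp_all
  then show False using dep_le[OF odd_bits] by (meson not_less_eq_eq)
qed

text \<open>No leg starts downwards. From an odd centre all legs, at least two, would start with the
  single upward edge. From an even centre they start inside the subcube, where \<open>d\<close>
  directions do not suffice for \<open>d + 1\<close> legs.\<close>

lemma base_star_free: "\<not> contains_copy (spanning base_edges) star"
proof
  assume "contains_copy (spanning base_edges) star"
  then obtain L c where "\<forall>i<Suc d. L i 0 = c"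
      "\<forall>i<Suc d. \<forall>l<h + 2. {L i l, L i (Suc l)} \<in> base_edges"
      "\<forall>i<Suc d. \<forall>j<Suc d. \<forall>l\<le>h + 2. \<forall>l'\<le>h + 2. L i l = L j l' \<longrightarrow> gstar_vertex i l = gstar_vertex j l'"
    unfolding contains_star_iff[OF base_edges_hypercube] by (elim exE conjE)
  note L = this
  have L0: "L i 0 = c" if "i < Suc d" for i using L(1) that by simp
  have Le: "{L i l, L i (Suc l)} \<in> base_edges" if "i < Suc d" "l < h + 2" for i l
    using L(2) that by simp
  have Lne: "L i l \<noteq> L j l'"
    if "i < Suc d" "j < Suc d" "l \<le> h + 2" "l' \<le> h + 2" "gstar_vertex i l \<noteq> gstar_vertex j l'"
    for i j l l' using L(3)[rule_format, OF that(1-4)] that(5) by blast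
  have no: False if "i < Suc d" "L i 1 \<in> odd_side d n" "up (L i 1) = c" for i
  proof (rule no_descending_leg[of "L i"])
    show "L i (Suc (Suc l)) \<noteq> L i l" if "Suc l < h + 2" for l
      using \<open>i < Suc d\<close> that by (intro Lne) (auto simp: gstar_vertex_def)
  qed (use that L0 Le in auto)
  have first: "{c, L i 1} \<in> base_edges" if "i < Suc d" for i
    using Le[OF that, of 0] L0[OF that] by simp
  have inj: "L i 1 \<noteq> L j 1" if "i < Suc d" "j < Suc d" "i \<noteq> j" for i j
    using that by (intro Lne) (auto simp: gstar_vertex_def)
  show False
  proof (cases "c \<in> odd_side d n")
    case True
    have "L i 1 = up c" if "i < Suc d" for i
    proof -
      have "{c, L i 1} \<notin> even_edges"
        using True odd_not_even flip_even_side_low dn by (force simp: even_edges_def doubleton_eq_iff)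
      then obtain u where "u \<in> odd_side d n" "{c, L i 1} = {u, up u}"
        using first[OF \<open>i < Suc d\<close>] by (auto simp: base_edges_def)
      then show ?thesis using no[OF \<open>i < Suc d\<close>] by (auto simp: doubleton_eq_iff)
    qed
    then have "L 0 1 = L 1 1" using d0 by simp
    then show False using inj[of 0 1] d0 by simp
  next
    case False
    have "L i 1 \<in> (\<lambda>j. flip j c) ` {..<d}" if "i < Suc d" for i
    proof -
      have "\<not> (\<exists>u\<in>odd_side d n. {c, L i 1} = {u, up u})"
        using no[OF that] False by (auto simp: doubleton_eq_iff)
      then have "{c, L i 1} \<in> even_edges"
        using first[OF \<open>i < Suc d\<close>] by (auto simp: base_edges_def)
      then obtain x j where x: "{c, L i 1} = {x, flip j x}" "x \<in> even_side d n" "j < d"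
        by (auto simp: even_edges_def)
      then have "L i 1 = flip j c"
        using flip_flip[OF cube_bits[OF even_cube[OF x(2)]], of j] dn by (auto simp: doubleton_eq_iff)
      then show ?thesis using x(3) by auto
    qed
    then have "(\<lambda>i. L i 1) ` {..<Suc d} \<subseteq> (\<lambda>j. flip j c) ` {..<d}" by auto
    then have "card ((\<lambda>i. L i 1) ` {..<Suc d}) \<le> card ((\<lambda>j. flip j c) ` {..<d})"
      by (intro card_mono) auto
    also have "\<dots> \<le> d" using card_image_le[of "{..<d}"] by simp
    finally show False using inj by (subst (asm) card_image) (auto simp: inj_on_def)
  qed
qed

text \<open>The \<open>d\<close> legs at \<open>x\<close> supplied by \<open>legs\<close> keep the
  coordinates from \<open>d\<close> on and use only even edges. A path all of whose vertices change
  one of these coordinates is disjoint from them and, cut after \<open>h + 2\<close> steps, serves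
  as the last leg.\<close>

lemma star_from_path:
  assumes F: "even_edges \<subseteq> F" "F \<subseteq> edges (hypercube n)"
    and x: "x \<in> even_side d n"
    and xs: "distinct xs" "h + 2 \<le> length xs" "chain F (x # xs)" "\<forall>y\<in>set xs. \<exists>j\<ge>d. y j \<noteq> x j"
  shows "contains_copy (spanning F) star"
proof -
  obtain L where L: "legs_from d n (h + 2) x L" using legs[OF even_cube[OF x]] by blast
  define M where "M i l = (if i < d then L i l else (x # xs) ! l)" for i l
  have side: "L i l \<in> even_side d n" if "i < d" "l \<le> h + 2" for i l
  proof -
    have "(\<Sum>j\<in>{d..<n}. L i l j) = (\<Sum>j\<in>{d..<n}. x j)"
      using legs_fromD(3)[OF L that] by (intro sum.cong) auto
    then show ?thesis using legs_fromD(2)[OF L that] x by (auto simp: even_side_def odd_side_def)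
  qed
  have M0: "M i 0 = x" if "i < Suc d" for i
    using that legs_fromD(1)[OF L] by (simp add: M_def)
  have Me: "{M i l, M i (Suc l)} \<in> F" if "i < Suc d" "l < h + 2" for i l
  proof (cases "i < d")
    case True
    then obtain j where "j < d" "L i (Suc l) = flip j (L i l)"
      using legs_fromD(4)[OF L] \<open>l < h + 2\<close> by blast
    moreover have "L i l \<in> even_side d n" using side[OF True] that(2) by simp
    ultimately have "{L i l, L i (Suc l)} \<in> even_edges" by (auto simp: even_edges_def)
    with True show ?thesis using F by (auto simp: M_def)
  next
    case False
    have "{(x # xs) ! l, (x # xs) ! Suc l} \<in> F"
      using xs(2,3) that(2) by (intro successively_nth[where P = "\<lambda>u v. {u, v} \<in> F"]) auto
    with False show ?thesis by (simp add: M_def)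
  qed
  have cross: "gstar_vertex i l = gstar_vertex j l'"
    if "i < d" "l \<le> h + 2" "j = d" "l' \<le> h + 2" "L i l = (x # xs) ! l'" for i j l l'
  proof -
    have "l' = 0"
    proof (rule ccontr)
      assume "l' \<noteq> 0"
      then have "L i l \<in> set xs" using that xs(2) by (cases l') auto
      then obtain j where "d \<le> j" "L i l j \<noteq> x j" using xs(4) by blast
      then show False using legs_fromD(3)[OF L that(1,2)] by simp
    qed
    then have "L i l = L i 0" using that legs_fromD(1)[OF L that(1)] by simp
    then have "gstar_vertex i l = gstar_vertex i 0" using that by (intro legs_from_inj[OF L]) auto
    with \<open>l' = 0\<close> show ?thesis by (simp add: gstar_vertex_def)
  qed
  have "x \<notin> set xs" using xs(4) by blast
  then have dist: "distinct (x # xs)" using xs(1) by simp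
  have Mi: "gstar_vertex i l = gstar_vertex j l'"
    if "i < Suc d" "j < Suc d" "l \<le> h + 2" "l' \<le> h + 2" "M i l = M j l'" for i j l l'
  proof -
    from that(1,2) consider "i < d" "j < d" | "i < d" "j = d" | "i = d" "j < d" | "i = d" "j = d"
      unfolding less_Suc_eq by blast
    then show ?thesis
    proof cases
      case 1
      then show ?thesis using that by (intro legs_from_inj[OF L]) (auto simp: M_def)
    next
      case 2
      then show ?thesis using that by (intro cross) (auto simp: M_def)
    next
      case 3
      then have "gstar_vertex j l' = gstar_vertex i l" using that by (intro cross) (auto simp: M_def)
      then show ?thesis by simp
    next
      case 4
      then have "(x # xs) ! l = (x # xs) ! l'" using that(5) by (simp add: M_def)
      moreover have "l < length (x # xs)" "l' < length (x # xs)" using that xs(2) by auto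
      ultimately have "l = l'" using dist nth_eq_iff_index_eq by blast
      with 4 show ?thesis by simp
    qed
  qed
  show ?thesis
    unfolding contains_star_iff[OF F(2)] using M0 Me Mi
    by (intro exI[of _ M] exI[of _ x] conjI allI impI)
qed

section \<open>Roots and root paths\<close>

definition "rt x = (par D ^^ dep x) x"

definition "ancestors x = map (\<lambda>i. (par D ^^ i) x) [0..<Suc (dep x)]"

lemma ancestor:
  assumes "bits r x" "i \<le> dep x"
  shows "bits r ((par D ^^ i) x) \<and> dep ((par D ^^ i) x) = dep x - i \<and>
    (\<forall>j\<ge>r. (par D ^^ i) x j = x j) \<and> pt ((par D ^^ i) x) = pt x"
  using assms(2)
proof (induction i)
  case (Suc i)
  let ?y = "(par D ^^ i) x"
  have IH: "bits r ?y" "dep ?y = dep x - i" "\<forall>j\<ge>r. ?y j = x j" "pt ?y = pt x" using Suc by auto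
  have "0 < dep ?y" using IH(2) Suc.prems by simp
  note step = D_less[OF IH(1) this] dep_par[OF IH(1) this] pt_par[OF IH(1) this]
  have "bits r (par D ?y)" using IH(1) by (simp add: par_def)
  moreover have "par D ?y j = x j" if "r \<le> j" for j
    using IH(3) step(1) that by (simp add: par_def)
  ultimately show ?case using step IH Suc.prems by simp
qed (use assms in auto)

lemma ancestor_odd:
  assumes "x \<in> odd_side d n" "i \<le> dep x"
  shows "(par D ^^ i) x \<in> odd_side d n"
  using assms(2)
proof (induction i)
  case (Suc i)
  then have "0 < dep ((par D ^^ i) x)" using ancestor[OF odd_bits[OF assms(1)], of i] by auto
  then show ?case using Suc par_odd by simp
qed (use assms in auto)

lemma rt_ancestor:
  assumes "x \<in> odd_side d n" "i \<le> dep x"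
  shows "rt ((par D ^^ i) x) = rt x"
proof -
  have "(par D ^^ (dep x - i)) ((par D ^^ i) x) = (par D ^^ (dep x - i + i)) x"
    by (simp only: funpow_add o_apply)
  with assms ancestor[OF odd_bits[OF assms(1)] assms(2)] show ?thesis by (simp add: rt_def)
qed

lemma rt_props:
  assumes "x \<in> odd_side d n"
  shows "rt x \<in> odd_side d n" "dep (rt x) = 0" "\<And>j. r \<le> j \<Longrightarrow> rt x j = x j" "pt (rt x) = pt x"
  using ancestor[OF odd_bits[OF assms], of "dep x"] ancestor_odd[OF assms, of "dep x"]
  by (auto simp: rt_def)

lemma length_ancestors [simp]: "length (ancestors x) = Suc (dep x)"
  by (simp add: ancestors_def)

lemma ancestors_nth: "i \<le> dep x \<Longrightarrow> ancestors x ! i = (par D ^^ i) x"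
  unfolding ancestors_def by (subst nth_map) (auto simp del: upt_Suc)

lemma ancestors_not_Nil [simp]: "ancestors x \<noteq> []"
  by (simp add: ancestors_def)

lemma hd_ancestors [simp]: "hd (ancestors x) = x"
  using ancestors_nth[of 0 x] by (simp add: hd_conv_nth)

lemma last_ancestors [simp]: "last (ancestors x) = rt x"
  using ancestors_nth[of "dep x" x] by (simp add: last_conv_nth rt_def)

text \<open>The last clause recovers an ancestor from its depth; with it, two root paths that meet
  are seen to agree from there on.\<close>

lemma in_ancestors:
  assumes "x \<in> odd_side d n" "y \<in> set (ancestors x)"
  shows "y \<in> odd_side d n \<and> rt y = rt x \<and> dep y \<le> dep x \<and> y = (par D ^^ (dep x - dep y)) x"
proof -
  obtain i where "i \<le> dep x" "y = (par D ^^ i) x"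
    using assms(2) by (auto simp: ancestors_def less_Suc_eq_le simp del: upt_Suc)
  with ancestor[OF odd_bits[OF assms(1)], of i] show ?thesis
    using ancestor_odd[OF assms(1)] rt_ancestor[OF assms(1)] by auto
qed

lemma distinct_ancestors:
  assumes "x \<in> odd_side d n"
  shows "distinct (ancestors x)"
proof -
  have "inj_on (\<lambda>i. (par D ^^ i) x) (set [0..<Suc (dep x)])"
  proof (rule inj_onI)
    fix i j assume "i \<in> set [0..<Suc (dep x)]" "j \<in> set [0..<Suc (dep x)]"
      "(par D ^^ i) x = (par D ^^ j) x"
    then have *: "i \<le> dep x" "j \<le> dep x" "(par D ^^ i) x = (par D ^^ j) x"
      by (auto simp del: upt_Suc)
    then have "dep x - i = dep x - j"
      using ancestor[OF odd_bits[OF assms], of i] ancestor[OF odd_bits[OF assms], of j] by auto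
    with * show "i = j" by auto
  qed
  then show ?thesis unfolding ancestors_def distinct_map by (simp del: upt_Suc)
qed

lemma chain_ancestors:
  assumes "x \<in> odd_side d n" "base_edges \<subseteq> F"
  shows "chain F (ancestors x)"
  unfolding successively_conv_nth
proof (intro allI impI)
  fix i assume "Suc i < length (ancestors x)"
  then have i: "Suc i \<le> dep x" by simp
  let ?y = "(par D ^^ i) x"
  have "?y \<in> odd_side d n" "dep ?y \<noteq> 0"
    using ancestor_odd[OF assms(1), of i] ancestor[OF odd_bits[OF assms(1)], of i] i by auto
  then have "{?y, up ?y} \<in> base_edges" "up ?y = par D ?y" by (auto simp: base_edges_def up_def)
  then show "{ancestors x ! i, ancestors x ! Suc i} \<in> F"
    using i assms(2) by (auto simp: ancestors_nth)
qed

lemma chain_rev: "chain F (rev xs) \<longleftrightarrow> chain F xs"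
  by (simp add: insert_commute)

text \<open>Coordinates below \<open>r\<close> may change freely, since the parity is taken over
  those from \<open>d\<close> on and \<open>r \<le> d\<close>.\<close>

lemma arm_odd:
  assumes "x \<in> odd_side d n" "bits r z" "\<forall>i\<ge>r. z i = x i"
  shows "z \<in> odd_side d n"
proof -
  have "z i = 0 \<or> z i = 1" if "i < n" for i
    using assms that bitsD[OF cube_bits[OF odd_cube[OF assms(1)]] that]
    by (cases "i < r") (auto simp: bits_def)
  then have "z \<in> cube n"
    using odd_cube[OF assms(1)] assms(3) rd dn by (auto simp: cube_iff bits_def)
  moreover have "(\<Sum>i\<in>{d..<n}. z i) = (\<Sum>i\<in>{d..<n}. x i)"
    using assms(3) rd by (intro sum.cong) auto
  ultimately show ?thesis using assms(1) by (simp add: odd_side_def)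
qed

lemma arms_odd:
  assumes "x \<in> odd_side d n" "dep x = 0"
  obtains z z' where "z \<in> odd_side d n" "z' \<in> odd_side d n" "dep z = h" "dep z' = h"
    "rt z = x" "rt z' = x" "0 < h \<Longrightarrow> (par D ^^ (h - 1)) z \<noteq> (par D ^^ (h - 1)) z'"
proof -
  obtain z z' where *: "bits r z \<and> bits r z' \<and>
      (\<forall>i\<ge>r. z i = x i \<and> z' i = x i) \<and> dep z = h \<and> dep z' = h \<and>
      (par D ^^ h) z = x \<and> (par D ^^ h) z' = x \<and>
      (0 < h \<longrightarrow> (par D ^^ (h - 1)) z \<noteq> (par D ^^ (h - 1)) z')"
    using arms[OF odd_bits[OF assms(1)] assms(2)] by (elim exE)
  show thesis
  proof (rule that)
    show "z \<in> odd_side d n" "z' \<in> odd_side d n" using * by (auto intro: arm_odd[OF assms(1)])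
  qed (use * in \<open>auto simp: rt_def\<close>)
qed

text \<open>An arm read downwards. It is one vertex short of what \<open>star_from_path\<close>
  needs.\<close>

lemma root_path:
  assumes "x \<in> odd_side d n" "dep x = 0" "base_edges \<subseteq> F"
  obtains xs where "distinct xs" "chain F xs" "xs \<noteq> []" "hd xs = x" "length xs = h + 1"
    "\<forall>y\<in>set xs. y \<in> odd_side d n \<and> rt y = x"
proof -
  obtain z where z: "z \<in> odd_side d n" "dep z = h" "rt z = x" using arms_odd[OF assms(1,2)] by metis
  show thesis
  proof (rule that[of "rev (ancestors z)"])
    show "chain F (rev (ancestors z))" unfolding chain_rev by (rule chain_ancestors[OF z(1) assms(3)])
    show "\<forall>y\<in>set (rev (ancestors z)). y \<in> odd_side d n \<and> rt y = x"
      using in_ancestors[OF z(1)] z(3) by auto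
  qed (use z distinct_ancestors in \<open>auto simp: hd_rev\<close>)
qed

text \<open>Walk up to the root and then down the arm that does not start with the branch of \<open>x\<close>.\<close>

lemma long_path:
  assumes x: "x \<in> odd_side d n" "0 < dep x" and F: "base_edges \<subseteq> F"
  obtains xs where "distinct xs" "chain F xs" "xs \<noteq> []" "hd xs = x" "h + 2 \<le> length xs"
    "\<forall>y\<in>set xs. y \<in> odd_side d n \<and> rt y = rt x"
proof -
  have "0 < h" using dep_le[OF odd_bits[OF x(1)]] x(2) by simp
  obtain z z' where "z \<in> odd_side d n" "z' \<in> odd_side d n" "dep z = h" "dep z' = h"
    "rt z = rt x" "rt z' = rt x" "(par D ^^ (h - 1)) z \<noteq> (par D ^^ (h - 1)) z'"
    using arms_odd[OF rt_props(1,2)[OF x(1)]] \<open>0 < h\<close> by metis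
  \<comment> \<open>At least one of the two arms starts with a child of the root that is not an
    ancestor of \<open>x\<close>.\<close>
  then obtain z where z: "z \<in> odd_side d n" "dep z = h" "rt z = rt x"
    "(par D ^^ (h - 1)) z \<noteq> (par D ^^ (dep x - 1)) x" by metis
  \<comment> \<open>A common vertex other than the root would give both root paths the same child of
    the root.\<close>
  have disj: "y = rt x" if "y \<in> set (ancestors x)" "y \<in> set (ancestors z)" for y
  proof (rule ccontr)
    assume "y \<noteq> rt x"
    note y = in_ancestors[OF x(1) that(1)] in_ancestors[OF z(1) that(2)]
    have "0 < dep y" using \<open>y \<noteq> rt x\<close> y by (auto simp: rt_def intro: gr0I)
    have "(par D ^^ (dep w - 1)) w = (par D ^^ (dep y - 1)) y"
      if "dep y \<le> dep w" "y = (par D ^^ (dep w - dep y)) w" for w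
    proof -
      have "(par D ^^ (dep y - 1)) y = (par D ^^ (dep y - 1 + (dep w - dep y))) w"
        using that(2) by (simp only: funpow_add o_apply)
      with that \<open>0 < dep y\<close> show ?thesis by simp
    qed
    from this[of x] this[of z] y z show False by simp
  qed
  let ?b = "butlast (ancestors z)"
  have spl: "ancestors z = ?b @ [rt x]" using append_butlast_last_id[of "ancestors z"] z(3) by simp
  have "chain F (rev (ancestors z))" unfolding chain_rev by (rule chain_ancestors[OF z(1) F])
  moreover have "rev (ancestors z) = rt x # rev ?b" by (subst spl) simp
  ultimately have ch: "chain F (rt x # rev ?b)" by (simp only:)
  have db: "distinct ?b" "rt x \<notin> set ?b"
    using distinct_ancestors[OF z(1)] by (subst (asm) spl, simp)+
  have sb: "set ?b \<subseteq> set (ancestors z)" by (auto dest: in_set_butlastD)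
  show thesis
  \<comment> \<open>This list has \<open>dep x + 1 + h\<close> vertices, which is enough because
    \<open>x\<close> is not a root.\<close>
  proof (rule that[of "ancestors x @ rev ?b"])
    show "distinct (ancestors x @ rev ?b)"
      using distinct_ancestors[OF x(1)] db disj sb by auto
    show "chain F (ancestors x @ rev ?b)"
      using chain_ancestors[OF x(1) F] ch unfolding successively_append_iff successively_Cons by auto
    show "\<forall>y\<in>set (ancestors x @ rev ?b). y \<in> odd_side d n \<and> rt y = rt x"
      using in_ancestors[OF x(1)] in_ancestors[OF z(1)] z(3) sb by auto
  qed (use x z in auto)
qed

section \<open>New edges that create a star\<close>

lemma root_edge:
  assumes "y \<in> odd_side d n" "dep y = 0"
  shows "flip d y \<in> even_side d n" "{flip d y, y} \<in> base_edges"
proof -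
  show "flip d y \<in> even_side d n" using assms dn by (intro flip_odd_side_high) auto
  show "{flip d y, y} \<in> base_edges"
    using assms by (auto simp: base_edges_def up_def insert_commute intro!: exI[of _ y])
qed

text \<open>For a path in the odd side the disjointness condition of \<open>star_from_path\<close>
  holds by parity.\<close>

lemma star_from_odd_path:
  assumes F: "base_edges \<subseteq> F" "F \<subseteq> edges (hypercube n)"
    and "x \<in> even_side d n" "distinct xs" "h + 2 \<le> length xs" "chain F xs" "{x, hd xs} \<in> F"
    and "set xs \<subseteq> odd_side d n"
  shows "contains_copy (spanning F) star"
proof (rule star_from_path)
  show "even_edges \<subseteq> F" using F(1) by (auto simp: base_edges_def)
  show "chain F (x # xs)" using assms by (auto simp: successively_Cons)
  show "\<forall>y\<in>set xs. \<exists>j\<ge>d. y j \<noteq> x j" using sides_differ assms by blast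
qed (use assms in auto)

text \<open>The last leg enters the tree of \<open>y\<close> at its root from the even side, walks
  down to \<open>y\<close>, crosses to \<open>x\<close> and follows a long path there. The two trees
  are disjoint because their roots differ.\<close>

lemma cross_edge_nonroot:
  assumes F: "base_edges \<subseteq> F" "F \<subseteq> edges (hypercube n)"
    and xy: "x \<in> odd_side d n" "y \<in> odd_side d n" "rt x \<noteq> rt y" "{y, x} \<in> F" "0 < dep x"
  shows "contains_copy (spanning F) star"
proof -
  obtain xs where xs: "distinct xs" "chain F xs" "xs \<noteq> []" "hd xs = x" "h + 2 \<le> length xs"
    "\<forall>w\<in>set xs. w \<in> odd_side d n \<and> rt w = rt x"
    using long_path[OF xy(1,5) F(1)] by blast
  let ?ys = "rev (ancestors y)"
  note root = rt_props(1,2)[OF xy(2)]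
  show ?thesis
  proof (rule star_from_odd_path[OF F root_edge(1)[OF root], of "?ys @ xs"])
    show "distinct (?ys @ xs)"
      using xs distinct_ancestors[OF xy(2)] in_ancestors[OF xy(2)] xy(3) by auto
    show "h + 2 \<le> length (?ys @ xs)" using xs by simp
    show "chain F (?ys @ xs)"
      unfolding successively_append_iff chain_rev
      using xs xy chain_ancestors[OF xy(2) F(1)] by (auto simp: last_rev)
    show "{flip d (rt y), hd (?ys @ xs)} \<in> F"
      using root_edge(2)[OF root] F(1) by (auto simp: hd_rev)
    show "set (?ys @ xs) \<subseteq> odd_side d n"
      using xs in_ancestors[OF xy(2)] by auto
  qed
qed

text \<open>From the even neighbour of \<open>y\<close> the leg visits \<open>y\<close>,
  \<open>x\<close> and an arm at \<open>x\<close>, exactly \<open>h + 2\<close> vertices.\<close>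

lemma cross_edge_roots:
  assumes F: "base_edges \<subseteq> F" "F \<subseteq> edges (hypercube n)"
    and xy: "x \<in> odd_side d n" "y \<in> odd_side d n" "x \<noteq> y" "{y, x} \<in> F" "dep x = 0" "dep y = 0"
  shows "contains_copy (spanning F) star"
proof -
  obtain xs where xs: "distinct xs" "chain F xs" "xs \<noteq> []" "hd xs = x" "length xs = h + 1"
    "\<forall>w\<in>set xs. w \<in> odd_side d n \<and> rt w = x"
    using root_path[OF xy(1,5) F(1)] by blast
  have "rt y = y" using xy by (simp add: rt_def)
  show ?thesis
  proof (rule star_from_odd_path[OF F root_edge(1)[OF xy(2,6)], of "y # xs"])
    show "distinct (y # xs)" using xs xy(3) \<open>rt y = y\<close> by auto
    show "chain F (y # xs)" using xs xy by (simp add: successively_Cons)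
    show "{flip d y, hd (y # xs)} \<in> F" using root_edge(2)[OF xy(2,6)] F(1) by auto
  qed (use xs xy in auto)
qed

lemma cross_edge:
  assumes F: "base_edges \<subseteq> F" "F \<subseteq> edges (hypercube n)"
    and xy: "x \<in> odd_side d n" "y \<in> odd_side d n" "rt x \<noteq> rt y" "{x, y} \<in> F"
  shows "contains_copy (spanning F) star"
proof -
  consider "0 < dep x" | "0 < dep y" | "dep x = 0" "dep y = 0" by blast
  then show ?thesis
  proof cases
    case 1
    then show ?thesis using xy cross_edge_nonroot[OF F, of x y] by (simp add: insert_commute)
  next
    case 2
    then show ?thesis using xy cross_edge_nonroot[OF F, of y x] by (simp add: insert_commute)
  next
    case 3
    moreover have "x \<noteq> y" using xy(3) by auto
    ultimately show ?thesis using xy cross_edge_roots[OF F, of x y] by (simp add: insert_commute)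
  qed
qed

text \<open>If \<open>u\<close> is not a root, a long path starts at \<open>u\<close>. If it is one,
  then \<open>i \<noteq> d\<close>, and the leg passes through \<open>u\<close> and its root edge
  into the even subcube of \<open>flip d u\<close>. That is not the subcube of the centre
  \<open>flip i u\<close>, as coordinate \<open>d\<close> differs.\<close>

lemma side_edge:
  assumes F: "base_edges \<subseteq> F" "F \<subseteq> edges (hypercube n)"
    and u: "u \<in> odd_side d n" "d \<le> i" "i < n" "i \<noteq> d \<or> 0 < dep u" "{flip i u, u} \<in> F"
  shows "contains_copy (spanning F) star"
proof (cases "0 < dep u")
  case True
  then obtain xs where "distinct xs" "chain F xs" "xs \<noteq> []" "hd xs = u" "h + 2 \<le> length xs"
    "\<forall>w\<in>set xs. w \<in> odd_side d n \<and> rt w = rt u"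
    using long_path[OF u(1) _ F(1)] by blast
  then show ?thesis
    using u flip_odd_side_high[OF u(2,3,1)] by (intro star_from_odd_path[OF F, of "flip i u" xs]) auto
next
  case False
  then have root: "dep u = 0" and "i \<noteq> d" using u by auto
  let ?c = "flip d u"
  note c = root_edge[OF u(1) root]
  obtain L where L: "legs_from d n (h + 2) ?c L" using legs[OF even_cube[OF c(1)]] by blast
  let ?ys = "map (L 0) [0..<Suc (h + 1)]"
  have EF: "even_edges \<subseteq> F" using F(1) by (auto simp: base_edges_def)
  have Leven: "L 0 l \<in> even_side d n" if "l \<le> h + 2" for l
  proof -
    have "(\<Sum>j\<in>{d..<n}. L 0 l j) = (\<Sum>j\<in>{d..<n}. ?c j)"
      using legs_fromD(3)[OF L d0 that] by (intro sum.cong) auto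
    then show ?thesis using legs_fromD(2)[OF L d0 that] c(1) by (auto simp: even_side_def odd_side_def)
  qed
  show ?thesis
  proof (rule star_from_path[OF EF F(2) flip_odd_side_high[OF u(2,3,1)], of "u # ?ys"])
    have "inj_on (L 0) {0..<Suc (h + 1)}"
    proof (rule inj_onI)
      fix l l' assume "l \<in> {0..<Suc (h + 1)}" "l' \<in> {0..<Suc (h + 1)}" "L 0 l = L 0 l'"
      then have "gstar_vertex 0 l = gstar_vertex 0 l'"
        by (intro legs_from_inj[OF L _ d0 d0]) simp_all
      then show "l = l'" by (auto simp: gstar_vertex_def split: if_splits)
    qed
    moreover have "u \<notin> set ?ys"
    proof
      assume "u \<in> set ?ys"
      then obtain l where "l < Suc (h + 1)" "u = L 0 l" by (auto simp del: upt_Suc)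
      then show False using Leven[of l] u(1) odd_not_even by simp
    qed
    ultimately show "distinct (u # ?ys)" by (simp add: distinct_map del: upt_Suc)
    show "h + 2 \<le> length (u # ?ys)" by simp
    have "chain F ?ys"
      unfolding successively_conv_nth
    proof (intro allI impI)
      fix l assume "Suc l < length ?ys"
      then have l: "Suc l < Suc (h + 1)" by (simp del: upt_Suc)
      then obtain j where "j < d" "L 0 (Suc l) = flip j (L 0 l)"
        using legs_fromD(4)[OF L d0, of l] by auto
      moreover have "L 0 l \<in> even_side d n" using l by (intro Leven) simp
      ultimately have "{L 0 l, L 0 (Suc l)} \<in> even_edges" by (auto simp: even_edges_def)
      then show "{?ys ! l, ?ys ! Suc l} \<in> F" using l EF by (auto simp del: upt_Suc)
    qed
    moreover have "hd ?ys = ?c" using legs_fromD(1)[OF L d0] by (simp add: hd_map del: upt_Suc)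
    moreover have "{u, ?c} \<in> F" using c(2) F(1) by (auto simp: insert_commute)
    ultimately show "chain F (flip i u # u # ?ys)"
      using u(5) by (simp add: successively_Cons del: upt_Suc)
    have "\<exists>j\<ge>d. L 0 l j \<noteq> flip i u j" if "l \<le> h + 2" for l
    proof -
      have "L 0 l d = 1 - u d" using legs_fromD(3)[OF L d0 that, of d] by simp
      moreover have "flip i u d = u d" using \<open>i \<noteq> d\<close> by simp
      ultimately have "L 0 l d \<noteq> flip i u d" using bitsD[OF cube_bits[OF odd_cube[OF u(1)]] dn] by auto
      then show ?thesis by blast
    qed
    moreover have "\<exists>j\<ge>d. u j \<noteq> flip i u j"
      using sides_differ[OF flip_odd_side_high[OF u(2,3,1)] u(1)] .
    ultimately show "\<forall>y\<in>set (u # ?ys). \<exists>j\<ge>d. y j \<noteq> flip i u j"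
      by (auto simp del: upt_Suc)
  qed
qed

text \<open>An edge inside the odd side that is not allowed flips a coordinate from \<open>r\<close>
  on or changes \<open>pt\<close>. Roots inherit these data from the vertices, so the ends have
  different roots and \<open>cross_edge\<close> applies. Edges between the sides fall under
  \<open>side_edge\<close>.\<close>

lemma forbidden_edge:
  assumes e: "e \<in> edges (hypercube n)" "e \<notin> allowed_edges"
  shows "contains_copy (spanning (insert e base_edges)) star"
proof -
  let ?F = "insert e base_edges"
  have F: "base_edges \<subseteq> ?F" "?F \<subseteq> edges (hypercube n)" using e base_edges_hypercube by auto
  obtain x i where x: "e = {x, flip i x}" "x \<in> cube n" "i < n" using e by (auto simp: edges_hypercube)
  have main: ?thesis if e: "e = {u, flip i u}" and u: "u \<in> odd_side d n" for u
  proof (cases "i < d")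
    case True
    then have fu: "flip i u \<in> odd_side d n" using u dn by (intro flip_odd_side_low) auto
    have "rt u \<noteq> rt (flip i u)"
    proof
      assume eq: "rt u = rt (flip i u)"
      have "i < r"
      proof (rule ccontr)
        assume "\<not> i < r"
        then have "u i = flip i u i"
          using rt_props(3)[OF u, of i] rt_props(3)[OF fu, of i] eq by simp
        then show False using bitsD[OF cube_bits[OF odd_cube[OF u]] x(3)] by auto
      qed
      moreover have "pt (flip i u) = pt u" using rt_props(4)[OF u] rt_props(4)[OF fu] eq by simp
      ultimately have "e \<in> allowed_edges" using e u by (auto simp: allowed_edges_def)
      with \<open>e \<notin> allowed_edges\<close> show False ..
    qed
    then show ?thesis using cross_edge[OF F u fu] e by simp
  next
    case False
    have "i \<noteq> d \<or> 0 < dep u"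
    proof (rule ccontr)
      assume "\<not> (i \<noteq> d \<or> 0 < dep u)"
      then have "e \<in> allowed_edges" using e u by (auto simp: allowed_edges_def)
      with \<open>e \<notin> allowed_edges\<close> show False ..
    qed
    then show ?thesis using side_edge[OF F u, of i] False e x(3) by (simp add: insert_commute)
  qed
  show ?thesis
  proof (cases "x \<in> odd_side d n")
    case True
    with main x show ?thesis by blast
  next
    case False
    then have ev: "x \<in> even_side d n" using x by (simp add: even_side_def)
    have "\<not> i < d"
    proof
      assume "i < d"
      with ev x have "e \<in> allowed_edges" by (auto simp: allowed_edges_def even_edges_def)
      with e show False by blast
    qed
    then have "flip i x \<in> odd_side d n" using ev x by (intro flip_even_side_high) auto
    moreover have "e = {flip i x, flip i (flip i x)}"
      using x flip_flip[OF cube_bits[OF x(2)] x(3)] by (simp add: insert_commute)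
    ultimately show ?thesis using main by blast
  qed
qed

text \<open>An inclusion-maximal star-free graph above \<open>base_edges\<close> is saturated. All
  its edges are allowed, because any other edge creates a star together with
  \<open>base_edges\<close> alone.\<close>

lemma sat_number_le: "sat_number (hypercube n) star \<le> card allowed_edges"
proof -
  let ?Q = "edges (hypercube n)"
  let ?A = "{F. base_edges \<subseteq> F \<and> F \<subseteq> ?Q \<and> \<not> contains_copy (spanning F) star}"
  have fin: "finite ?A" by (rule finite_subset[of _ "Pow ?Q"]) (auto simp: finite_edges_hypercube)
  have "base_edges \<in> ?A" using base_star_free base_edges_hypercube by simp
  from finite_has_maximal2[OF fin this] obtain F
    where F: "F \<in> ?A" "base_edges \<subseteq> F" "\<forall>G\<in>?A. F \<subseteq> G \<longrightarrow> F = G"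
    by (elim bexE conjE)
  have FQ: "F \<subseteq> ?Q" "\<not> contains_copy (spanning F) star" using F(1) by auto
  have sat: "saturated (hypercube n) star (spanning F)"
    unfolding saturated_def
  proof (intro conjI ballI)
    show "subgraph_of (spanning F) (hypercube n)"
      using FQ spanning_simple[OF FQ(1)] by (auto simp: subgraph_of_def spanning_def verts_hypercube)
    show "\<not> contains_copy (spanning F) star" by (rule FQ)
    fix e assume e: "e \<in> ?Q - edges (spanning F)"
    then have e': "e \<in> ?Q" "e \<notin> F" by (auto simp: spanning_def)
    have "e \<subseteq> cube n" using e'(1) by (auto simp: edges_hypercube)
    then have "add_edge e (spanning F) = spanning (insert e F)"
      by (auto simp: add_edge_def spanning_def)
    moreover have "insert e F \<notin> ?A" using bspec[OF F(3), of "insert e F"] e'(2) by blast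
    ultimately show "contains_copy (add_edge e (spanning F)) star" using F(2) FQ e'(1) by auto
  qed
  have "F \<subseteq> allowed_edges"
  proof
    fix e assume "e \<in> F"
    show "e \<in> allowed_edges"
    proof (rule ccontr)
      assume "e \<notin> allowed_edges"
      then have "contains_copy (spanning (insert e base_edges)) star"
        using FQ \<open>e \<in> F\<close> by (intro forbidden_edge) auto
      then have "contains_copy (spanning F) star"
        using FQ \<open>e \<in> F\<close> F(2) base_edges_hypercube
        by (elim contains_copy_mono) (auto simp: simple_gstar spanning_def intro!: spanning_simple[unfolded spanning_def])
      with FQ show False by blast
    qed
  qed
  moreover have "finite allowed_edges"
  proof (rule finite_subset[of _ "Pow (cube n)"])
    show "allowed_edges \<subseteq> Pow (cube n)"
      using dn rd by (auto simp: allowed_edges_def even_edges_def intro: odd_cube even_cube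
        intro!: flip_cube)
  qed simp
  ultimately have "card F \<le> card allowed_edges" by (intro card_mono)
  moreover have "sat_number (hypercube n) star \<le> card F"
    unfolding sat_number_def
  proof (rule Min_le)
    have "card (edges H) \<le> card ?Q" if "saturated (hypercube n) star H" for H
      using that finite_edges_hypercube by (intro card_mono) (auto simp: saturated_def subgraph_of_def)
    then have "{card (edges H) | H. saturated (hypercube n) star H} \<subseteq> {..card ?Q}" by auto
    then show "finite {card (edges H) | H. saturated (hypercube n) star H}"
      by (rule finite_subset) simp
    show "card F \<in> {card (edges H) | H. saturated (hypercube n) star H}"
      using sat by (intro CollectI exI[of _ "spanning F"]) (simp add: spanning_def)
  qed
  ultimately show ?thesis by simp
qed

end

subsection \<open>Counting edges\<close>

text \<open>Edges are counted twice: an edge inside the tile is seen from both ends, but a root edge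
  only from the root, hence the 2.\<close>

definition tile_weight :: "nat \<Rightarrow> ((nat \<Rightarrow> nat) \<Rightarrow> nat) \<Rightarrow> ((nat \<Rightarrow> nat) \<Rightarrow> bool) \<Rightarrow> (nat \<Rightarrow> nat) \<Rightarrow> nat" where
  "tile_weight r dep pt x = card {i. i < r \<and> pt (flip i x) = pt x} + (if dep x = 0 then 2 else 0)"

text \<open>\<open>P\<close> holds both orientations of each edge, exchanged by the flip, so the
  half with \<open>x i = 0\<close> already yields all edges.\<close>

lemma card_flip_edges:
  assumes P: "P \<subseteq> cube n \<times> {..<n}" and sym: "\<And>x i. (x, i) \<in> P \<Longrightarrow> (flip i x, i) \<in> P"
  shows "2 * card {{x, flip i x} | x i. (x, i) \<in> P} \<le> card P"
proof -
  have fin: "finite P" using P by (rule finite_subset) simp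
  define P0 where "P0 = {p \<in> P. fst p (snd p) = 0}"
  define P1 where "P1 = {p \<in> P. fst p (snd p) = 1}"
  let ?f = "\<lambda>(x, i). (flip i x, i)"
  have val: "x i = 0 \<or> x i = 1" "flip i (flip i x) = x" if "(x, i) \<in> P" for x i
    using that P bitsD[OF cube_bits, of x n i] flip_flip[OF cube_bits, of x n i] by auto
  have "bij_betw ?f P0 P1"
    by (rule bij_betwI[of _ _ _ ?f]) (auto simp: P0_def P1_def val intro: sym)
  then have eq: "card P0 = card P1" by (rule bij_betw_same_card)
  have "P0 \<union> P1 = P" using val(1) by (fastforce simp: P0_def P1_def)
  moreover have "P0 \<inter> P1 = {}" by (auto simp: P0_def P1_def)
  moreover have "finite P0" "finite P1" using fin by (auto simp: P0_def P1_def)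
  ultimately have "card P = card P0 + card P1" by (metis card_Un_disjoint)
  moreover have "{{x, flip i x} | x i. (x, i) \<in> P} \<subseteq> (\<lambda>(x, i). {x, flip i x}) ` P0"
  proof
    fix e assume "e \<in> {{x, flip i x} | x i. (x, i) \<in> P}"
    then obtain x i where e: "e = {x, flip i x}" "(x, i) \<in> P" by blast
    show "e \<in> (\<lambda>(x, i). {x, flip i x}) ` P0"
    proof (cases "x i = 0")
      case True
      then have "(x, i) \<in> P0" using e by (simp add: P0_def)
      then show ?thesis using e(1) by force
    next
      case False
      then have "(flip i x, i) \<in> P0" using e sym val(1)[OF e(2)] by (auto simp: P0_def)
      moreover have "e = {flip i x, flip i (flip i x)}" using e val by auto
      ultimately show ?thesis by force
    qed
  qed
  then have "card {{x, flip i x} | x i. (x, i) \<in> P} \<le> card P0"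
    using \<open>finite P0\<close> by (rule surj_card_le[rotated])
  ultimately show ?thesis using eq by simp
qed

context saturating
begin

lemma card_even_edges: "2 * card even_edges \<le> d * 2 ^ (n - 1)"
proof -
  have "2 * card {{x, flip i x} | x i. (x, i) \<in> even_side d n \<times> {..<d}} \<le> card (even_side d n \<times> {..<d})"
    using dn by (intro card_flip_edges[where n = n])
      (auto intro: even_cube flip_even_side_low)
  then show ?thesis using card_sides[OF dn] by (simp add: even_edges_def card_cartesian_product mult.commute)
qed

lemma card_allowed_edges_le_sum:
  "2 * card allowed_edges \<le> d * 2 ^ (n - 1) + (\<Sum>u\<in>odd_side d n. tile_weight r dep pt u)"
proof -
  let ?O = "odd_side d n"
  let ?R = "{{u, flip d u} | u. u \<in> ?O \<and> dep u = 0}"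
  let ?P = "SIGMA u:?O. {i. i < r \<and> pt (flip i u) = pt u}"
  let ?I = "{{u, flip i u} | u i. u \<in> ?O \<and> i < r \<and> pt (flip i u) = pt u}"
  have fin: "finite ?O" by (simp add: odd_side_def)
  have "?R = (\<lambda>u. {u, flip d u}) ` {u \<in> ?O. dep u = 0}" by auto
  then have "card ?R \<le> card {u \<in> ?O. dep u = 0}" using fin by (simp add: card_image_le)
  moreover have "(\<Sum>u\<in>?O. if dep u = 0 then 2 else 0) = 2 * card {u \<in> ?O. dep u = 0}"
    using fin by (simp add: sum.If_cases Int_def)
  ultimately have R: "2 * card ?R \<le> (\<Sum>u\<in>?O. if dep u = 0 then 2 else 0)" by simp
  have "2 * card {{u, flip i u} | u i. (u, i) \<in> ?P} \<le> card ?P"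
  proof (rule card_flip_edges[where n = n])
    show "?P \<subseteq> cube n \<times> {..<n}" using rd dn odd_cube by auto
    fix u i assume "(u, i) \<in> ?P"
    then show "(flip i u, i) \<in> ?P"
      using rd dn flip_flip[OF cube_bits[OF odd_cube], of u i] by (auto intro: flip_odd_side_low)
  qed
  then have I: "2 * card ?I \<le> (\<Sum>u\<in>?O. card {i. i < r \<and> pt (flip i u) = pt u})"
    using fin by simp
  have "card allowed_edges \<le> card even_edges + card ?R + card ?I"
    unfolding allowed_edges_def by (intro order_trans[OF card_Un_le] add_mono card_Un_le order_refl)
  then show ?thesis
    using card_even_edges R I by (simp add: tile_weight_def sum.distrib)
qed

text \<open>Restriction to the first \<open>r\<close> coordinates has fibres of equal size on the
  odd side, since replacing these coordinates does not affect the parity. So \<open>f\<close> has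
  the same average over the side as over the tile.\<close>

lemma sum_odd_side:
  fixes f :: "(nat \<Rightarrow> nat) \<Rightarrow> nat"
  assumes local: "\<And>x y. (\<And>i. i < r \<Longrightarrow> x i = y i) \<Longrightarrow> f x = f y"
  shows "2 ^ r * (\<Sum>u\<in>odd_side d n. f u) = 2 ^ (n - 1) * (\<Sum>x\<in>cube r. f x)"
proof -
  let ?O = "odd_side d n"
  define fib where "fib x = {u \<in> ?O. restrict u {..<r} = x}" for x
  have fin: "finite ?O" by (simp add: odd_side_def)
  have img: "(\<lambda>u. restrict u {..<r}) ` ?O \<subseteq> cube r"
    using odd_bits by (fastforce simp: cube_iff bits_def)
  have le: "card (fib x) \<le> card (fib y)" if "x \<in> cube r" "y \<in> cube r" for x y
  proof -
    let ?m = "\<lambda>u i. if i < r then y i else u i"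
    have "inj_on ?m (fib x)"
    proof (rule inj_onI)
      fix u w assume uw: "u \<in> fib x" "w \<in> fib x" "?m u = ?m w"
      show "u = w"
      proof
        fix i show "u i = w i"
        proof (cases "i < r")
          case True
          have "restrict u {..<r} i = restrict w {..<r} i" using uw by (simp add: fib_def)
          with True show ?thesis by simp
        next
          case False
          with fun_cong[OF uw(3), of i] show ?thesis by simp
        qed
      qed
    qed
    moreover have "?m ` fib x \<subseteq> fib y"
    proof
      fix w assume "w \<in> ?m ` fib x"
      then obtain u where u: "u \<in> ?O" "w = ?m u" by (auto simp: fib_def)
      have "bits r w" using that(2) u(2) by (auto simp: cube_iff bits_def)
      then have "w \<in> ?O" using arm_odd[OF u(1)] u(2) by auto
      moreover have "restrict w {..<r} = y" using u(2) that(2) by (auto simp: fun_eq_iff cube_iff)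
      ultimately show "w \<in> fib y" by (simp add: fib_def)
    qed
    ultimately show ?thesis using fin by (intro card_inj_on_le) (auto simp: fib_def)
  qed
  define z where "z = restrict (\<lambda>_::nat. 0::nat) {..<r}"
  have "z \<in> cube r" by (simp add: z_def cube_iff bits_def)
  then have eq: "card (fib x) = card (fib z)" if "x \<in> cube r" for x
    using le that by (intro antisym) auto
  have sum: "(\<Sum>u\<in>?O. g u) = card (fib z) * (\<Sum>x\<in>cube r. g x)"
    if g: "\<And>x y. (\<And>i. i < r \<Longrightarrow> x i = y i) \<Longrightarrow> g x = g y" for g :: "(nat \<Rightarrow> nat) \<Rightarrow> nat"
  proof -
    have "(\<Sum>u\<in>?O. g u) = (\<Sum>x\<in>cube r. \<Sum>u\<in>fib x. g u)"
      unfolding fib_def by (rule sum.group[OF fin finite_cube img, symmetric])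
    also have "\<dots> = (\<Sum>x\<in>cube r. card (fib x) * g x)"
    proof (rule sum.cong)
      fix x assume "x \<in> cube r"
      have "g u = g x" if "u \<in> fib x" for u using that by (intro g) (auto simp: fib_def)
      then show "(\<Sum>u\<in>fib x. g u) = card (fib x) * g x" by simp
    qed simp
    also have "\<dots> = (\<Sum>x\<in>cube r. card (fib z) * g x)" using eq by (intro sum.cong) auto
    finally show ?thesis by (simp add: sum_distrib_left)
  qed
  \<comment> \<open>The common fibre size comes from summing the constant 1.\<close>
  have "2 ^ (n - 1) = card (fib z) * 2 ^ r"
    using sum[of "\<lambda>_. 1"] card_sides(1)[OF dn] by (simp add: card_cube)
  then show ?thesis using sum[OF local] by simp
qed

lemma sat_number_weight:
  assumes "(\<Sum>x\<in>cube r. tile_weight r dep pt x) \<le> C"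
  shows "2 ^ r * (2 * sat_number (hypercube n) star) \<le> 2 ^ (n - 1) * (d * 2 ^ r + C)"
proof -
  have "tile_weight r dep pt x = tile_weight r dep pt y" if "\<And>i. i < r \<Longrightarrow> x i = y i" for x y
  proof -
    have "pt (flip i x) = pt (flip i y)" for i
      using that by (intro local[THEN conjunct2, THEN conjunct2]) (auto simp: flip_apply)
    then show ?thesis using local[of x y] that by (simp add: tile_weight_def)
  qed
  then have "2 ^ r * (\<Sum>u\<in>odd_side d n. tile_weight r dep pt u)
      = 2 ^ (n - 1) * (\<Sum>x\<in>cube r. tile_weight r dep pt x)"
    by (rule sum_odd_side)
  also have "\<dots> \<le> 2 ^ (n - 1) * C" using assms by simp
  finally have *: "2 ^ r * (\<Sum>u\<in>odd_side d n. tile_weight r dep pt u) \<le> 2 ^ (n - 1) * C" .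
  have "2 ^ r * (2 * sat_number (hypercube n) star)
      \<le> 2 ^ r * (d * 2 ^ (n - 1) + (\<Sum>u\<in>odd_side d n. tile_weight r dep pt u))"
    using sat_number_le card_allowed_edges_le_sum by (intro mult_left_mono) auto
  with * show ?thesis by (simp add: algebra_simps)
qed

end

subsection \<open>Tiles from labellings and Gray codes\<close>

text \<open>For a single tree covering the tile: \<open>lab\<close> numbers the vertices of
  \<open>Q_r\<close> with the root as 0, and parents \<open>P\<close>, depths
  \<open>\<delta>\<close> and the two arms \<open>u\<close>, \<open>v\<close> are given on labels.
  As \<open>pt\<close> is constant, all \<open>r * 2 ^ r\<close> pairs of a vertex and a coordinate
  count, and the one root adds 2.\<close>

lemma labelled_tile:
  fixes lab :: "(nat \<Rightarrow> nat) \<Rightarrow> nat" and P \<delta> u v :: "nat \<Rightarrow> nat"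
  assumes lab_local: "\<And>x y. (\<And>i. i < r \<Longrightarrow> x i = y i) \<Longrightarrow> lab x = lab y"
    and lab_less: "\<And>x. bits r x \<Longrightarrow> lab x < N"
    and lab_inj: "\<And>x y i. bits r x \<Longrightarrow> bits r y \<Longrightarrow> lab x = lab y \<Longrightarrow> i < r \<Longrightarrow> x i = y i"
    and lab_surj: "\<And>l. l < N \<Longrightarrow> \<exists>x. bits r x \<and> lab x = l"
    and lab_step: "\<And>x. bits r x \<Longrightarrow> 0 < \<delta> (lab x) \<Longrightarrow> \<exists>i<r. lab (flip i x) = P (lab x)"
    and \<delta>_P: "\<And>l. l < N \<Longrightarrow> 0 < \<delta> l \<Longrightarrow> Suc (\<delta> (P l)) = \<delta> l"
    and \<delta>_le: "\<And>l. l < N \<Longrightarrow> \<delta> l \<le> h"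
    and \<delta>_0: "\<And>l. l < N \<Longrightarrow> \<delta> l = 0 \<Longrightarrow> l = 0"
    and u: "\<And>i. i \<le> h \<Longrightarrow> u i < N \<and> \<delta> (u i) = i" "\<And>i. i < h \<Longrightarrow> P (u (Suc i)) = u i"
    and v: "\<And>i. i \<le> h \<Longrightarrow> v i < N \<and> \<delta> (v i) = i" "\<And>i. i < h \<Longrightarrow> P (v (Suc i)) = v i"
    and uv: "0 < h \<Longrightarrow> u 1 \<noteq> v 1"
  shows "\<exists>D dep pt. rooted_tile r h D dep pt \<and> (\<Sum>x\<in>cube r. tile_weight r dep pt x) \<le> r * 2 ^ r + 2"
proof -
  \<comment> \<open>The choice depends on \<open>x\<close> only through the labels of
    \<open>x\<close> and its flips, hence only on the first \<open>r\<close> coordinates, as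
    \<open>local\<close> requires.\<close>
  define D where "D x = (SOME i. i < r \<and> lab (flip i x) = P (lab x))" for x
  define dep where "dep x = \<delta> (lab x)" for x
  let ?pt = "\<lambda>_ :: nat \<Rightarrow> nat. True"
  have D: "D x < r \<and> lab (par D x) = P (lab x)" if "bits r x" "0 < dep x" for x
    using someI_ex[of "\<lambda>i. i < r \<and> lab (flip i x) = P (lab x)"] lab_step[of x] that
    by (simp add: D_def dep_def par_def)
  have bits_par: "bits r (par D x)" if "bits r x" for x using that by (simp add: par_def)
  \<comment> \<open>Start at the vertex labelled \<open>w h\<close> in the copy of the tile that
    contains \<open>x\<close>. The parents run back through \<open>w\<close> to
    \<open>w 0 = 0\<close>, the label of \<open>x\<close>.\<close>
  have arm: "\<exists>z. bits r z \<and> (\<forall>i\<ge>r. z i = x i) \<and> dep z = h \<and> (par D ^^ h) z = x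
      \<and> (0 < h \<longrightarrow> lab ((par D ^^ (h - 1)) z) = w 1)"
    if w': "\<forall>i\<le>h. w i < N \<and> \<delta> (w i) = i" "\<forall>i<h. P (w (Suc i)) = w i"
      and x: "bits r x" "dep x = 0" for w x
  proof -
    have w: "i \<le> h \<Longrightarrow> w i < N \<and> \<delta> (w i) = i" "i < h \<Longrightarrow> P (w (Suc i)) = w i" for i
      using w' by simp_all
    obtain z0 where z0: "bits r z0" "lab z0 = w h" using lab_surj w(1) by blast
    define z where "z i = (if i < r then z0 i else x i)" for i
    have z: "bits r z" "lab z = w h" "\<forall>i\<ge>r. z i = x i"
      using z0 lab_local[of z z0] by (auto simp: z_def bits_def)
    have it: "bits r ((par D ^^ i) z) \<and> lab ((par D ^^ i) z) = w (h - i) \<and>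
        (\<forall>j\<ge>r. (par D ^^ i) z j = x j)" if "i \<le> h" for i
      using that
    proof (induction i)
      case (Suc i)
      let ?y = "(par D ^^ i) z"
      have IH: "bits r ?y" "lab ?y = w (h - i)" "\<forall>j\<ge>r. ?y j = x j" using Suc by auto
      have "h - i = Suc (h - Suc i)" using Suc.prems by simp
      then have "lab ?y = w (Suc (h - Suc i))" using IH(2) by simp
      moreover have "0 < dep ?y" using IH(2) w(1)[of "h - i"] Suc.prems by (simp add: dep_def)
      moreover have "P (w (Suc (h - Suc i))) = w (h - Suc i)" using Suc.prems by (intro w(2)) simp
      ultimately have "D ?y < r" "lab (par D ?y) = w (h - Suc i)" using D[OF IH(1)] by auto
      moreover have "par D ?y j = x j" if "r \<le> j" for j
        using IH(3) \<open>D ?y < r\<close> that by (simp add: par_def)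
      ultimately show ?case using bits_par[OF IH(1)] by simp
    qed (use z in auto)
    have "w 0 = 0" using w(1)[of 0] \<delta>_0 by simp
    moreover have "lab x = 0" using x lab_less \<delta>_0 by (simp add: dep_def)
    ultimately have lh: "lab ((par D ^^ h) z) = lab x" using it[of h] by simp
    have "(par D ^^ h) z = x"
    proof
      fix i show "(par D ^^ h) z i = x i"
        using it[of h] lab_inj[of "(par D ^^ h) z" x i] x(1) lh by (cases "i < r") auto
    qed
    moreover have "lab ((par D ^^ (h - 1)) z) = w 1" if "0 < h" using it[of "h - 1"] that by simp
    moreover have "dep z = h" using z(2) w(1)[of h] by (simp add: dep_def)
    ultimately show ?thesis using z by blast
  qed
  have "rooted_tile r h D dep ?pt"
  proof
    fix x y :: "nat \<Rightarrow> nat" assume xy: "\<And>i. i < r \<Longrightarrow> x i = y i"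
    have "lab (flip i x) = lab (flip i y)" for i using xy by (intro lab_local) (auto simp: flip_apply)
    moreover have "lab x = lab y" using xy by (rule lab_local)
    ultimately show "dep x = dep y \<and> D x = D y \<and> True = True" by (simp add: dep_def D_def)
  next
    fix x :: "nat \<Rightarrow> nat" assume x: "bits r x"
    show "dep x \<le> h" using \<delta>_le lab_less[OF x] by (simp add: dep_def)
    show "D x < r" if "0 < dep x" using D[OF x that] by simp
    show "Suc (dep (par D x)) = dep x" if "0 < dep x"
      using D[OF x that] \<delta>_P[of "lab x"] lab_less[OF x] that by (simp add: dep_def)
    have u': "\<forall>i\<le>h. u i < N \<and> \<delta> (u i) = i" "\<forall>i<h. P (u (Suc i)) = u i"
      and v': "\<forall>i\<le>h. v i < N \<and> \<delta> (v i) = i" "\<forall>i<h. P (v (Suc i)) = v i"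
      using u v by simp_all
    assume x0: "dep x = 0"
    obtain z where z: "bits r z" "\<forall>i\<ge>r. z i = x i" "dep z = h" "(par D ^^ h) z = x"
      "0 < h \<longrightarrow> lab ((par D ^^ (h - 1)) z) = u 1"
      using arm[OF u' x x0] by (elim exE conjE)
    obtain z' where z': "bits r z'" "\<forall>i\<ge>r. z' i = x i" "dep z' = h" "(par D ^^ h) z' = x"
      "0 < h \<longrightarrow> lab ((par D ^^ (h - 1)) z') = v 1"
      using arm[OF v' x x0] by (elim exE conjE)
    have "0 < h \<longrightarrow> (par D ^^ (h - 1)) z \<noteq> (par D ^^ (h - 1)) z'"
      using z(5) z'(5) uv by metis
    with z z' show "\<exists>z z'. bits r z \<and> bits r z' \<and>
      (\<forall>i\<ge>r. z i = x i \<and> z' i = x i) \<and> dep z = h \<and> dep z' = h \<and>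
      (par D ^^ h) z = x \<and> (par D ^^ h) z' = x \<and>
      (0 < h \<longrightarrow> (par D ^^ (h - 1)) z \<noteq> (par D ^^ (h - 1)) z')"
      by (intro exI[of _ z] exI[of _ z']) simp
  qed simp
  moreover have "(\<Sum>x\<in>cube r. tile_weight r dep ?pt x) \<le> r * 2 ^ r + 2"
  proof -
    have "x = y" if "x \<in> cube r" "y \<in> cube r" "dep x = 0" "dep y = 0" for x y
    proof
      have "lab x = 0" "lab y = 0" using that \<delta>_0 lab_less cube_bits by (auto simp: dep_def)
      then have "lab x = lab y" by simp
      then show "x i = y i" for i
        using lab_inj[of x y i] that cube_bits by (cases "i < r") (auto simp: cube_iff)
    qed
    then have roots: "card {x \<in> cube r. dep x = 0} \<le> Suc 0"
      by (subst card_le_Suc0_iff_eq) auto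
    have "(\<Sum>x\<in>cube r. if dep x = 0 then 2 else 0) = 2 * card {x \<in> cube r. dep x = 0}"
      by (simp add: sum.If_cases Int_def)
    moreover have "(\<Sum>x\<in>cube r. card {i. i < r}) = r * 2 ^ r" by (simp add: card_cube)
    ultimately show ?thesis using roots
      by (simp add: tile_weight_def sum.distrib card_cube mult.commute)
  qed
  ultimately show ?thesis by blast
qed

section \<open>The position of a vertex in the reflected Gray code\<close>

fun gray :: "nat \<Rightarrow> (nat \<Rightarrow> nat) \<Rightarrow> nat" where
  "gray 0 x = 0"
| "gray (Suc s) x = (if x s = 0 then gray s x else 2 ^ Suc s - 1 - gray s x)"

lemma gray_local: "(\<And>i. i < s \<Longrightarrow> x i = y i) \<Longrightarrow> gray s x = gray s y"
  by (induction s) auto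

lemma gray_less: "gray s x < 2 ^ s"
  by (induction s) (auto simp: less_imp_diff_less intro: less_trans)

lemma gray_flip_ge [simp]: "s \<le> i \<Longrightarrow> gray s (flip i x) = gray s x"
  by (rule gray_local) auto

lemma gray_inj: "bits s x \<Longrightarrow> bits s y \<Longrightarrow> gray s x = gray s y \<Longrightarrow> i < s \<Longrightarrow> x i = y i"
proof (induction s)
  case (Suc s)
  have bits: "bits s x" "bits s y" using Suc.prems by (auto intro: bits_mono)
  have "x s = y s \<and> gray s x = gray s y"
    using Suc.prems(3) gray_less[of s x] gray_less[of s y]
      bitsD[OF Suc.prems(1), of s] bitsD[OF Suc.prems(2), of s]
    by (auto split: if_splits)
  then show ?case using Suc.IH[OF bits] Suc.prems(4) by (auto simp: less_Suc_eq)
qed simp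

lemma gray_surj: "p < 2 ^ s \<Longrightarrow> \<exists>x. bits s x \<and> gray s x = p"
proof (induction s arbitrary: p)
  case (Suc s)
  show ?case
  proof (cases "p < 2 ^ s")
    case True
    then obtain x where x: "bits s x" "gray s x = p" using Suc.IH by blast
    have "gray s (x(s := 0)) = p" unfolding x(2)[symmetric] by (rule gray_local) simp
    moreover have "bits (Suc s) (x(s := 0))" using x(1) by (auto simp: bits_def less_Suc_eq)
    ultimately show ?thesis by (intro exI[of _ "x(s := 0)"]) (simp del: fun_upd_apply add: fun_upd_same)
  next
    case False
    then have "2 ^ Suc s - 1 - p < 2 ^ s" using Suc.prems by auto
    then obtain x where x: "bits s x" "gray s x = 2 ^ Suc s - 1 - p" using Suc.IH by blast
    have "gray s (x(s := 1)) = 2 ^ Suc s - 1 - p" unfolding x(2)[symmetric] by (rule gray_local) simp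
    moreover have "bits (Suc s) (x(s := 1))" using x(1) by (auto simp: bits_def less_Suc_eq)
    ultimately show ?thesis using Suc.prems
      by (intro exI[of _ "x(s := 1)"]) (simp del: fun_upd_apply add: fun_upd_same)
  qed
qed (auto simp: bits_def)

text \<open>Between the two halves the top bit is flipped. Elsewhere the induction hypothesis
  applies, with the direction reversed in the upper half.\<close>

lemma gray_neighbours:
  assumes "bits s x"
  shows "(0 < gray s x \<longrightarrow> (\<exists>i<s. gray s (flip i x) = gray s x - 1)) \<and>
    (gray s x + 1 < 2 ^ s \<longrightarrow> (\<exists>i<s. gray s (flip i x) = gray s x + 1))"
  using assms
proof (induction s)
  case (Suc s)
  let ?g = "gray s x"
  have IH: "0 < ?g \<Longrightarrow> \<exists>i<s. gray s (flip i x) = ?g - 1"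
    "?g + 1 < 2 ^ s \<Longrightarrow> \<exists>i<s. gray s (flip i x) = ?g + 1"
    using Suc.IH bits_mono[OF Suc.prems, of s] by auto
  have low: "gray (Suc s) (flip i x) = (if x s = 0 then gray s (flip i x) else 2 ^ Suc s - 1 - gray s (flip i x))"
    if "i < s" for i using that by simp
  have top: "gray (Suc s) (flip s x) = (if x s = 0 then 2 ^ Suc s - 1 - ?g else ?g)"
    using bitsD[OF Suc.prems, of s] by auto
  have less: "?g < 2 ^ s" by (rule gray_less)
  show ?case
  proof (cases "x s = 0")
    case True
    have "\<exists>i<Suc s. gray (Suc s) (flip i x) = ?g - 1" if pos: "0 < ?g"
    proof -
      obtain i where "i < s" "gray s (flip i x) = ?g - 1" using IH(1) pos by blast
      then show ?thesis using low[of i] True by (intro exI[of _ i]) simp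
    qed
    moreover have "\<exists>i<Suc s. gray (Suc s) (flip i x) = ?g + 1"
    proof (cases "?g + 1 < 2 ^ s")
      case True
      then obtain i where "i < s" "gray s (flip i x) = ?g + 1" using IH(2) by blast
      then show ?thesis using low[of i] \<open>x s = 0\<close> by (intro exI[of _ i]) simp
    next
      case False
      then show ?thesis using top less \<open>x s = 0\<close> by (intro exI[of _ s]) simp
    qed
    ultimately show ?thesis using True by simp
  next
    case False
    have "\<exists>i<Suc s. gray (Suc s) (flip i x) = 2 ^ Suc s - 1 - ?g - 1"
    proof (cases "?g + 1 < 2 ^ s")
      case True
      then obtain i where "i < s" "gray s (flip i x) = ?g + 1" using IH(2) by blast
      then show ?thesis using low[of i] \<open>x s \<noteq> 0\<close> by (intro exI[of _ i]) simp
    next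
      case False
      then show ?thesis using top less \<open>x s \<noteq> 0\<close> by (intro exI[of _ s]) simp
    qed
    moreover have "\<exists>i<Suc s. gray (Suc s) (flip i x) = 2 ^ Suc s - 1 - ?g + 1" if pos: "0 < ?g"
    proof -
      obtain i where "i < s" "gray s (flip i x) = ?g - 1" using IH(1) pos by blast
      then show ?thesis using low[of i] False pos less by (intro exI[of _ i]) simp
    qed
    ultimately show ?thesis using False less by simp
  qed
qed simp

lemma gray_pred: "bits s x \<Longrightarrow> 0 < gray s x \<Longrightarrow> \<exists>i<s. gray s (flip i x) = gray s x - 1"
  using gray_neighbours by blast

text \<open>The last vertex has top bit 1 and lower position 0, so flipping the top bit closes the
  cycle.\<close>

lemma gray_last:
  assumes "bits (Suc s) x" "gray (Suc s) x = 2 ^ Suc s - 1"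
  shows "\<exists>i<Suc s. gray (Suc s) (flip i x) = 0"
  using assms bitsD[OF assms(1), of s] gray_less[of s x]
  by (intro exI[of _ s]) (auto split: if_splits)

lemma gray_succ:
  assumes "bits (Suc s) x"
  shows "\<exists>i<Suc s. gray (Suc s) (flip i x) = (gray (Suc s) x + 1) mod 2 ^ Suc s"
proof (cases "gray (Suc s) x + 1 < 2 ^ Suc s")
  case True
  then show ?thesis using gray_neighbours[OF assms] by (simp del: gray.simps power_Suc)
next
  case False
  then have "gray (Suc s) x = 2 ^ Suc s - 1" using gray_less[of "Suc s" x] by linarith
  then show ?thesis using gray_last[OF assms] by (simp del: gray.simps power_Suc)
qed

text \<open>Besides the Hamiltonian cycle one chord of it is needed.\<close>

lemma gray_chord:
  assumes "bits (Suc (Suc s)) x" "gray (Suc (Suc s)) x = 2 ^ Suc s"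
  shows "\<exists>i<Suc (Suc s). gray (Suc (Suc s)) (flip i x) = 2 ^ Suc (Suc s) - 1"
proof -
  have "x (Suc s) \<noteq> 0"
    by (rule notI) (use assms gray_less[of "Suc s" x] in
      \<open>simp add: gray.simps(2)[of "Suc s"] del: gray.simps(2)\<close>)
  \<comment> \<open>The upper half runs backwards through a smaller code, whose two ends are
    adjacent by \<open>gray_last\<close>.\<close>
  then have "gray (Suc s) x = 2 ^ Suc s - 1"
    using assms(2) gray_less[of "Suc s" x] by (simp add: gray.simps(2)[of "Suc s"] del: gray.simps(2))
  then obtain i where "i < Suc s" "gray (Suc s) (flip i x) = 0"
    using gray_last[of s x] assms(1) by (meson bits_mono le_SucI order_refl)
  then show ?thesis using \<open>x (Suc s) \<noteq> 0\<close>
    by (intro exI[of _ i]) (simp add: gray.simps(2)[of "Suc s"] del: gray.simps(2))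
qed

subsection \<open>Tiles for every leg length\<close>

lemma cube_0: "cube 0 = {\<lambda>_. undefined}"
  by (auto simp: cube_def)

text \<open>Lets the weights of the small tiles be computed by simplification.\<close>

lemma sum_cube_Suc: "(\<Sum>x\<in>cube (Suc r). f x) = (\<Sum>x\<in>cube r. f (x(r := 0)) + f (x(r := 1)))"
  for f :: "(nat \<Rightarrow> nat) \<Rightarrow> nat"
proof -
  have "bij_betw (\<lambda>(x, b). x(r := b)) (cube r \<times> {0, 1}) (cube (Suc r))"
    by (rule bij_betwI[of _ _ _ "\<lambda>y. (y(r := undefined), y r)"])
      (auto simp: cube_iff bits_def fun_eq_iff less_Suc_eq)
  then have "(\<Sum>x\<in>cube (Suc r). f x) = (\<Sum>p\<in>cube r \<times> {0, 1}. f (case p of (x, b) \<Rightarrow> x(r := b)))"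
    by (rule sum.reindex_bij_betw[symmetric])
  also have "\<dots> = (\<Sum>x\<in>cube r. \<Sum>b\<in>{0, 1}. f (x(r := b)))"
    by (subst sum.cartesian_product) (simp add: split_def)
  finally show ?thesis by simp
qed

lemma sum_cube_numeral: "(\<Sum>x\<in>cube (numeral k). f x)
    = (\<Sum>x\<in>cube (pred_numeral k). f (x(pred_numeral k := 0)) + f (x(pred_numeral k := 1)))"
  for f :: "(nat \<Rightarrow> nat) \<Rightarrow> nat"
  unfolding numeral_eq_Suc by (rule sum_cube_Suc)

lemma card_less_conj: "card {i. i < (r::nat) \<and> Q i} = (\<Sum>i<r. if Q i then 1 else 0)"
proof -
  have "card {i \<in> {..<r}. Q i} = (\<Sum>i<r. if Q i then 1 else 0)"
    unfolding card_eq_sum by (rule sum.inter_filter) simp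
  then show ?thesis by (simp only: lessThan_iff)
qed

text \<open>For \<open>m = 2\<close> the trees are single vertices.\<close>

lemma tile_2:
  "\<exists>D dep pt. rooted_tile 0 0 D dep pt \<and> (\<Sum>x\<in>cube 0. tile_weight 0 dep pt x) \<le> 2"
proof -
  have "rooted_tile 0 0 (\<lambda>_. 0) (\<lambda>_. 0) (\<lambda>_. True)"
  proof (unfold_locales, goal_cases)
    case (6 x)
    then show ?case by (intro exI[of _ x]) simp
  qed simp_all
  moreover have "(\<Sum>x\<in>cube 0. tile_weight 0 (\<lambda>_. 0) (\<lambda>_. True) x) \<le> 2"
    by (simp add: tile_weight_def cube_0)
  ultimately show ?thesis by blast
qed

text \<open>Two copies of \<open>K\<^sub>1\<^sub>,\<^sub>3\<close> centred at antipodal points; the parent of a leaf is reached by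
  flipping the coordinate that differs from the other two.\<close>

lemma tile_3:
  "\<exists>D dep pt. rooted_tile 3 1 D dep pt \<and> (\<Sum>x\<in>cube 3. tile_weight 3 dep pt x) \<le> 24"
proof -
  define D :: "(nat \<Rightarrow> nat) \<Rightarrow> nat" where
    "D x = (if x 0 \<noteq> x 1 \<and> x 0 \<noteq> x 2 then 0 else if x 1 \<noteq> x 0 \<and> x 1 \<noteq> x 2 then 1 else 2)" for x
  define dep :: "(nat \<Rightarrow> nat) \<Rightarrow> nat" where "dep x = (if x 0 = x 1 \<and> x 1 = x 2 then 0 else 1)" for x
  \<comment> \<open>The majority bit tells the two stars apart.\<close>
  define pt :: "(nat \<Rightarrow> nat) \<Rightarrow> bool" where "pt x \<longleftrightarrow> 2 \<le> x 0 + x 1 + x 2" for x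
  note defs = D_def dep_def pt_def par_def
  have bit: "(x 0 = 0 \<or> x 0 = 1) \<and> (x 1 = 0 \<or> x 1 = 1) \<and> (x 2 = 0 \<or> x 2 = 1)" if "bits 3 x" for x
    using that by (simp add: bits_def)
  have "rooted_tile 3 1 D dep pt"
  proof
    fix x y :: "nat \<Rightarrow> nat" assume "\<And>i. i < 3 \<Longrightarrow> x i = y i"
    then have "x 0 = y 0" "x 1 = y 1" "x 2 = y 2" by simp_all
    then show "dep x = dep y \<and> D x = D y \<and> pt x = pt y" by (simp add: defs)
  next
    fix x :: "nat \<Rightarrow> nat" assume x: "bits 3 x"
    show "dep x \<le> 1" by (simp add: dep_def)
    show "D x < 3" by (simp add: D_def)
    show "Suc (dep (par D x)) = dep x" "pt (par D x) = pt x" if "0 < dep x"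
      using bit[OF x] that by (elim conjE disjE; simp add: defs)+
    assume "dep x = 0"
    have "dep (flip i x) = 1" "D (flip i x) = i" "flip i (flip i x) = x" "bits 3 (flip i x)"
      "\<forall>j\<ge>3. flip i x j = x j" if "i = 0 \<or> i = 1" for i
      using bit[OF x] \<open>dep x = 0\<close> that x flip_flip[OF x, of i]
      by (elim conjE disjE; simp add: defs)+
    from this[of 0] this[of 1] show "\<exists>z z'. bits 3 z \<and> bits 3 z' \<and> (\<forall>i\<ge>3. z i = x i \<and> z' i = x i) \<and> dep z = 1 \<and> dep z' = 1
      \<and> (par D ^^ 1) z = x \<and> (par D ^^ 1) z' = x
      \<and> (0 < (1::nat) \<longrightarrow> (par D ^^ (1 - 1)) z \<noteq> (par D ^^ (1 - 1)) z')"
      using flip_inject[OF x, of 0 1]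
      by (intro exI[of _ "flip 0 x"] exI[of _ "flip 1 x"]) (auto simp: par_def)
  qed
  \<comment> \<open>24 is the budget \<open>(q + 2) * 2 ^ r\<close> of \<open>tile_exists\<close>
    for \<open>q = 1\<close>, \<open>r = 3\<close>.\<close>
  moreover have "(\<Sum>x\<in>cube 3. tile_weight 3 dep pt x) \<le> 24"
    by (simp add: sum_cube_numeral sum_cube_Suc cube_0 tile_weight_def card_less_conj
        lessThan_nat_numeral lessThan_Suc dep_def pt_def flip_def)
  ultimately show ?thesis by blast
qed

text \<open>Two trees rooted at antipodal points. The points of the middle layer are joined to the tree
  that contains the vertex obtained by flipping coordinate \<open>0\<close>.\<close>

lemma tile_4:
  "\<exists>D dep pt. rooted_tile 4 2 D dep pt \<and> (\<Sum>x\<in>cube 4. tile_weight 4 dep pt x) \<le> 56"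
proof -
  define w :: "(nat \<Rightarrow> nat) \<Rightarrow> nat" where "w x = x 0 + x 1 + x 2 + x 3" for x
  \<comment> \<open>In the layers of weight 1 and 3 this is the coordinate that differs from the
    other three.\<close>
  define D :: "(nat \<Rightarrow> nat) \<Rightarrow> nat" where
    "D x = (if w x = 2 \<or> x 0 \<noteq> x 1 \<and> x 0 \<noteq> x 2 then 0
      else if x 1 \<noteq> x 0 \<and> x 1 \<noteq> x 2 then 1 else if x 2 \<noteq> x 0 \<and> x 2 \<noteq> x 1 then 2 else 3)" for x
  define dep :: "(nat \<Rightarrow> nat) \<Rightarrow> nat" where
    "dep x = (if w x = 2 then 2 else if w x = 1 \<or> w x = 3 then 1 else 0)" for x
  define pt :: "(nat \<Rightarrow> nat) \<Rightarrow> bool" where "pt x \<longleftrightarrow> 3 \<le> w x \<or> w x = 2 \<and> x 0 = 0" for x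
  note defs = D_def dep_def pt_def par_def w_def
  have bit: "(x 0 = 0 \<or> x 0 = 1) \<and> (x 1 = 0 \<or> x 1 = 1) \<and> (x 2 = 0 \<or> x 2 = 1) \<and> (x 3 = 0 \<or> x 3 = 1)"
    if "bits 4 x" for x
    using that by (simp add: bits_def)
  have "rooted_tile 4 2 D dep pt"
  proof
    fix x y :: "nat \<Rightarrow> nat" assume "\<And>i. i < 4 \<Longrightarrow> x i = y i"
    then have "x 0 = y 0" "x 1 = y 1" "x 2 = y 2" "x 3 = y 3" by simp_all
    then show "dep x = dep y \<and> D x = D y \<and> pt x = pt y" by (simp add: defs)
  next
    fix x :: "nat \<Rightarrow> nat" assume x: "bits 4 x"
    show "dep x \<le> 2" by (simp add: dep_def)
    show "D x < 4" by (simp add: D_def)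
    show "Suc (dep (par D x)) = dep x" "pt (par D x) = pt x" if "0 < dep x"
      using bit[OF x] that by (elim conjE disjE; simp add: defs)+
    assume x0: "dep x = 0"
    \<comment> \<open>Middle vertices reach their parents by flipping coordinate 0, so the arms end
      with that flip; starting with coordinate 1 or 2 gives different children.\<close>
    have arm: "bits 4 z \<and> (\<forall>i\<ge>4. z i = x i) \<and> dep z = 2 \<and> par D z = flip i x \<and> par D (flip i x) = x"
      if i: "i = 1 \<or> i = 2" and z: "z = flip 0 (flip i x)" for i z
    proof -
      have "dep z = 2" "D z = 0" "D (flip i x) = i"
        using bit[OF x] x0 i unfolding z by (elim conjE disjE; simp add: defs)+
      moreover have "flip 0 z = flip i x" "flip i (flip i x) = x"
        using x i z flip_flip[of 4 "flip i x" 0] flip_flip[of 4 x i] by auto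
      moreover have "\<forall>j\<ge>4. z j = x j" using i z by (auto simp: flip_apply)
      ultimately show ?thesis using x z by (simp add: par_def)
    qed
    have ne: "flip 1 x \<noteq> flip 2 x" using flip_inject[OF x, of 1 2] by auto
    have it: "(par D ^^ 2) z = par D (par D z)" "(par D ^^ (2 - 1)) z = par D z" for z
      by (simp_all add: numeral_2_eq_2)
    show "\<exists>z z'. bits 4 z \<and> bits 4 z' \<and> (\<forall>i\<ge>4. z i = x i \<and> z' i = x i) \<and> dep z = 2 \<and> dep z' = 2
      \<and> (par D ^^ 2) z = x \<and> (par D ^^ 2) z' = x
      \<and> (0 < (2::nat) \<longrightarrow> (par D ^^ (2 - 1)) z \<noteq> (par D ^^ (2 - 1)) z')"
      unfolding it using ne arm[OF disjI1[OF refl] refl] arm[OF disjI2[OF refl] refl]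
      by - (rule exI[of _ "flip 0 (flip 1 x)"], rule exI[of _ "flip 0 (flip 2 x)"], simp)
  qed
  \<comment> \<open>56 is the budget of \<open>tile_exists\<close> for \<open>q = 1\<close>,
    \<open>t = 1\<close>, \<open>r = 4\<close>.\<close>
  moreover have "(\<Sum>x\<in>cube 4. tile_weight 4 dep pt x) \<le> 56"
    by (simp add: sum_cube_numeral sum_cube_Suc cube_0 tile_weight_def card_less_conj
        lessThan_nat_numeral lessThan_Suc dep_def pt_def flip_def w_def)
  ultimately show ?thesis by blast
qed

text \<open>The tree follows the Gray code cycle from its first vertex in both directions. One vertex would
  get depth \<open>2 ^ q\<close>, and is reached through the chord instead.\<close>

lemma tile_cycle:
  assumes "2 \<le> q"
  shows "\<exists>D dep pt. rooted_tile (Suc q) (2 ^ q - 1) D dep pt \<and>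
    (\<Sum>x\<in>cube (Suc q). tile_weight (Suc q) dep pt x) \<le> Suc q * 2 ^ Suc q + 2"
proof -
  define K where "K = (2::nat) ^ q"
  define M where "M = (2::nat) ^ Suc q"
  have M: "M = 2 * K" by (simp add: M_def K_def)
  have "(2::nat) ^ 2 \<le> K" unfolding K_def by (rule power_increasing) (use assms in auto)
  then have K: "4 \<le> K" by simp
  obtain q' where q': "q = Suc q'" using assms by (cases q) auto
  \<comment> \<open>Position \<open>K\<close> lies opposite the root on the cycle; the chord joins
    it to position \<open>M - 1\<close>, which has depth 1.\<close>
  define \<delta> where "\<delta> p = (if p < K then p else if p = K then 2 else M - p)" for p
  define P where "P p = (if p < K then p - 1 else if p = K then M - 1 else (p + 1) mod M)" for p
  note less = gray_less[of "Suc q", folded M_def]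
  have top: "K < l \<Longrightarrow> l < M \<Longrightarrow> l + 1 = M \<or> (l + 1 < M \<and> (l + 1) mod M = l + 1)" for l by auto
  show ?thesis
    unfolding K_def[symmetric]
  \<comment> \<open>The arms are the positions from 0 up to \<open>K - 1\<close> and from
    \<open>M - 1\<close> down to \<open>K + 1\<close>.\<close>
  proof (rule labelled_tile[where lab = "gray (Suc q)" and N = M and P = P and \<delta> = \<delta>
        and u = "\<lambda>i. i" and v = "\<lambda>i. if i = 0 then 0 else M - i"])
    fix x assume x: "bits (Suc q) x" and pos: "0 < \<delta> (gray (Suc q) x)"
    consider "gray (Suc q) x < K" | "gray (Suc q) x = K" | "K < gray (Suc q) x" by linarith
    then show "\<exists>i<Suc q. gray (Suc q) (flip i x) = P (gray (Suc q) x)"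
    proof cases
      case 1
      then show ?thesis using gray_pred[OF x] pos by (simp add: P_def \<delta>_def del: gray.simps)
    next
      case 2
      then show ?thesis using gray_chord[of q' x] x
        by (simp add: P_def K_def M_def q' del: gray.simps power_Suc)
    next
      case 3
      then show ?thesis using gray_succ[OF x] by (simp add: P_def M_def del: gray.simps power_Suc)
    qed
  next
    fix l assume "l < M" "0 < \<delta> l"
    then show "Suc (\<delta> (P l)) = \<delta> l"
      using K M top[of l] by (auto simp: \<delta>_def P_def split: if_splits)
  next
    fix x y :: "nat \<Rightarrow> nat" assume "\<And>i. i < Suc q \<Longrightarrow> x i = y i"
    then show "gray (Suc q) x = gray (Suc q) y" by (rule gray_local)
  next
    fix x y :: "nat \<Rightarrow> nat" and i assume "bits (Suc q) x" "bits (Suc q) y" "gray (Suc q) x = gray (Suc q) y" "i < Suc q"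
    then show "x i = y i" by (rule gray_inj)
  next
    fix l assume l: "l < M"
    then show "\<exists>x. bits (Suc q) x \<and> gray (Suc q) x = l" by (intro gray_surj) (simp only: M_def)
    show "\<delta> l \<le> K - 1" using l K M by (auto simp: \<delta>_def)
    show "\<delta> l = 0 \<Longrightarrow> l = 0" using l K by (auto simp: \<delta>_def split: if_splits)
  next
    fix i assume i: "i \<le> K - 1"
    then show "i < M \<and> \<delta> i = i" using K M by (auto simp: \<delta>_def)
    show "(if i = 0 then 0 else M - i) < M \<and> \<delta> (if i = 0 then 0 else M - i) = i"
      using i K M by (auto simp: \<delta>_def)
  next
    fix i assume i: "i < K - 1"
    then show "P (Suc i) = i" using K M by (auto simp: P_def)
    have "\<not> M - Suc i < K" "M - Suc i \<noteq> K" "M - Suc i + 1 = M - i" using i M by auto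
    then show "P (if Suc i = 0 then 0 else M - Suc i) = (if i = 0 then 0 else M - i)"
      using K M by (simp add: P_def)
  next
    show "1 \<noteq> (if 1 = (0::nat) then 0 else M - 1)" using K M by simp
  qed (rule less)
qed

text \<open>The two arms run in two copies \<open>A\<close> and \<open>B\<close> of the Gray code cycle, with labels below \<open>M\<close> and from \<open>M\<close>
  on. The rest of \<open>A\<close> follows the cycle backwards, and the rest of \<open>B\<close> hangs on \<open>A\<close>, except for
  the first vertex behind the arm: its neighbours in the arms are too deep.\<close>

lemma tile_two_cycles:
  assumes "2 \<le> q" "0 < t" "t < 2 ^ q"
  shows "\<exists>D dep pt. rooted_tile (Suc (Suc q)) (2 ^ q - 1 + t) D dep pt \<and>
    (\<Sum>x\<in>cube (Suc (Suc q)). tile_weight (Suc (Suc q)) dep pt x) \<le> Suc (Suc q) * 2 ^ Suc (Suc q) + 2"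
proof -
  define K where "K = (2::nat) ^ q"
  define M where "M = (2::nat) ^ Suc q"
  define h where "h = K - 1 + t"
  have M: "M = 2 * K" by (simp add: M_def K_def)
  have "(2::nat) ^ 2 \<le> K" unfolding K_def by (rule power_increasing) (use assms in auto)
  then have K: "4 \<le> K" by simp
  have t: "0 < t" "t < K" using assms by (auto simp: K_def)
  obtain q' where q': "q = Suc q'" using assms by (cases q) auto
  let ?s = "Suc q"
  define lab where "lab x = (if x ?s = 0 then gray ?s x else M + gray ?s x)" for x
  define \<delta>A where "\<delta>A p = (if p \<le> h then p else M - p)" for p
  define PA where "PA p = (if p \<le> h then p - 1 else (p + 1) mod M)" for p
  \<comment> \<open>The second arm enters \<open>B\<close> at position 0, so depths there are
    shifted by one and position \<open>h\<close> would get \<open>h + 1\<close>. For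
    \<open>t \<ge> 2\<close> its successor gives it depth \<open>M - h + 1 \<le> h\<close>. For
    \<open>t = 1\<close> that value is \<open>h + 1\<close> again, but then \<open>h = K\<close> and
    the chord leads to position \<open>M - 1\<close> of \<open>B\<close>, which has depth 2.\<close>
  define \<delta>B where "\<delta>B p = (if p < h then p + 1 else if p = h then (if t = 1 then 3 else M - h + 1)
    else M - p + 1)" for p
  define PB where "PB p = (if p = 0 then 0 else if p < h then M + (p - 1)
    else if p = h then (if t = 1 then M + (M - 1) else M + (h + 1)) else p)" for p
  define \<delta> where "\<delta> l = (if l < M then \<delta>A l else \<delta>B (l - M))" for l
  define P where "P l = (if l < M then PA l else PB (l - M))" for l
  note less = gray_less[of ?s, folded M_def]
  \<comment> \<open>The arm passes the middle of the cycle, and at least position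
    \<open>h + 1\<close> remains behind it.\<close>
  have hK: "K \<le> h" "h + 2 \<le> M" "4 \<le> h" using t K M by (auto simp: h_def)
  have top: "h < l \<Longrightarrow> l < M \<Longrightarrow> l + 1 = M \<or> (l + 1 < M \<and> (l + 1) mod M = l + 1)" for l by auto
  show ?thesis
    unfolding K_def[symmetric] h_def[symmetric]
  proof (rule labelled_tile[where lab = lab and N = "2 * M" and P = P and \<delta> = \<delta>
        and u = "\<lambda>i. i" and v = "\<lambda>i. if i = 0 then 0 else M + (i - 1)"])
    fix x assume x: "bits (Suc ?s) x" and pos: "0 < \<delta> (lab x)"
    let ?p = "gray ?s x"
    have xs: "bits ?s x" using x by (rule bits_mono) simp
    have low: "\<exists>i<Suc ?s. lab (flip i x) = (if x ?s = 0 then a else M + a)"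
      if "\<exists>i<?s. gray ?s (flip i x) = a" for a
    proof -
      from that obtain i where "i < ?s" "gray ?s (flip i x) = a" by blast
      then show ?thesis by (intro exI[of _ i]) (simp add: lab_def del: gray.simps)
    qed
    have across: "lab (flip ?s x) = ?p" if "x ?s \<noteq> 0"
      using that bitsD[OF x, of ?s] by (simp add: lab_def del: gray.simps)
    show "\<exists>i<Suc ?s. lab (flip i x) = P (lab x)"
    proof (cases "x ?s = 0")
      case A: True
      then have P: "P (lab x) = PA ?p" "\<delta> (lab x) = \<delta>A ?p"
        using less by (simp_all add: lab_def P_def \<delta>_def del: gray.simps)
      show ?thesis
      proof (cases "?p \<le> h")
        case True
        then have "0 < ?p" using pos P by (simp add: \<delta>A_def del: gray.simps)
        then show ?thesis using low[OF gray_pred[OF xs]] A P True by (simp add: PA_def del: gray.simps)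
      next
        case False
        then show ?thesis using low[OF gray_succ[OF xs]] A P
          by (simp add: PA_def M_def del: gray.simps power_Suc)
      qed
    next
      case B: False
      then have P: "P (lab x) = PB ?p" by (simp add: lab_def P_def del: gray.simps)
      consider "?p = 0 \<or> h < ?p" | "0 < ?p" "?p < h" | "?p = h" "t = 1" | "?p = h" "t \<noteq> 1" by linarith
      then show ?thesis
      proof cases
        case 1
        then have "P (lab x) = ?p" using P by (auto simp: PB_def simp del: gray.simps)
        then show ?thesis using across[OF B] by (intro exI[of _ ?s]) simp
      next
        case 2
        then show ?thesis using low[OF gray_pred[OF xs]] B P by (simp add: PB_def del: gray.simps)
      next
        case 3
        then have "gray (Suc (Suc q')) x = 2 ^ Suc q'" using K by (simp add: h_def K_def q' del: gray.simps)
        then have "\<exists>i<?s. gray ?s (flip i x) = M - 1"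
          using gray_chord[of q' x] xs by (simp only: M_def q')
        from low[OF this] show ?thesis using B P 3 hK by (simp add: PB_def del: gray.simps)
      next
        case 4
        have "\<exists>i<?s. gray ?s (flip i x) = h + 1"
          using gray_succ[OF xs] 4 hK by (simp add: M_def del: gray.simps power_Suc)
        from low[OF this] show ?thesis using B P 4 hK by (simp add: PB_def del: gray.simps)
      qed
    qed
  next
    fix l assume l: "l < 2 * M" and pos: "0 < \<delta> l"
    show "Suc (\<delta> (P l)) = \<delta> l"
    proof (cases "l < M")
      case True
      have "0 < l" by (rule ccontr) (use True pos in \<open>simp add: \<delta>_def \<delta>A_def\<close>)
      have "PA l < M" using True K M by (auto simp: PA_def)
      moreover have "Suc (\<delta>A (PA l)) = \<delta>A l"
        using True \<open>0 < l\<close> hK top[of l] by (auto simp: \<delta>A_def PA_def)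
      ultimately show ?thesis using True by (simp add: \<delta>_def P_def)
    next
      case False
      define p where "p = l - M"
      have p: "l = M + p" "p < M" using False l by (auto simp: p_def)
      consider "p = 0" | "0 < p" "p < h" | "p = h" "t = 1" | "p = h" "t \<noteq> 1" | "h < p" by linarith
      then have "Suc (\<delta> (PB p)) = \<delta>B p"
      proof cases
        case 5
        then have "PB p = p" "p < M" using p by (auto simp: PB_def)
        then show ?thesis using 5 by (simp add: \<delta>_def \<delta>A_def \<delta>B_def)
      next
        case 3
        then have "PB p = M + (M - 1)" using hK by (simp add: PB_def)
        moreover have "\<delta> (M + (M - 1)) = 2" using hK by (auto simp: \<delta>_def \<delta>B_def)
        ultimately show ?thesis using 3 by (simp add: \<delta>B_def)
      next
        case 4
        then have "PB p = M + (h + 1)" using hK by (simp add: PB_def)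
        then show ?thesis using 4 hK by (simp add: \<delta>_def \<delta>B_def)
      qed (use hK p in \<open>auto simp: \<delta>_def PB_def \<delta>A_def \<delta>B_def\<close>)
      then show ?thesis using p by (simp add: \<delta>_def P_def)
    qed
  next
    fix x y :: "nat \<Rightarrow> nat" assume xy: "\<And>i. i < Suc ?s \<Longrightarrow> x i = y i"
    have "gray ?s x = gray ?s y" by (rule gray_local) (use xy in simp)
    then show "lab x = lab y" using xy[of ?s] by (simp add: lab_def del: gray.simps)
  next
    fix x show "lab x < 2 * M" using less[of x] by (simp add: lab_def del: gray.simps)
  next
    fix x y :: "nat \<Rightarrow> nat" and i assume xy: "bits (Suc ?s) x" "bits (Suc ?s) y" "lab x = lab y" "i < Suc ?s"
    have "x ?s = y ?s \<and> gray ?s x = gray ?s y"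
      using xy(3) less[of x] less[of y] bitsD[OF xy(1), of ?s] bitsD[OF xy(2), of ?s]
      by (auto simp: lab_def simp del: gray.simps split: if_splits)
    moreover have "bits ?s x" "bits ?s y" using xy by (auto intro: bits_mono)
    ultimately show "x i = y i"
      using gray_inj[of ?s x y i] xy(4) by (cases "i = ?s") (auto simp del: gray.simps)
  next
    fix l assume l: "l < 2 * M"
    have ex: "\<exists>x. bits (Suc ?s) x \<and> x ?s = b \<and> gray ?s x = p" if "p < M" "b = 0 \<or> b = 1" for p b
    proof -
      have "p < 2 ^ ?s" using that(1) by (simp only: M_def)
      then obtain x where x: "bits ?s x" "gray ?s x = p" using gray_surj by blast
      have "gray ?s (x(?s := b)) = p" unfolding x(2)[symmetric] by (rule gray_local) simp
      moreover have "bits (Suc ?s) (x(?s := b))"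
        using x(1) that(2) by (auto simp: bits_def less_Suc_eq)
      ultimately show ?thesis by (intro exI[of _ "x(?s := b)"]) (simp del: fun_upd_apply gray.simps add: fun_upd_same)
    qed
    show "\<exists>x. bits (Suc ?s) x \<and> lab x = l"
    proof (cases "l < M")
      case True
      then show ?thesis using ex[of l 0] by (auto simp: lab_def simp del: gray.simps)
    next
      case False
      then have "l - M < M" using l by simp
      then obtain x where "bits (Suc ?s) x" "x ?s = 1" "gray ?s x = l - M" using ex[of "l - M" 1] by blast
      then show ?thesis using False by (intro exI[of _ x]) (simp add: lab_def del: gray.simps)
    qed
    have "\<delta>A l \<le> h" if "l < M" for l using that hK M by (auto simp: \<delta>A_def h_def)
    moreover have "\<delta>B p \<le> h" if "p < M" for p
      using that t K M by (auto simp: \<delta>B_def h_def)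
    ultimately show "\<delta> l \<le> h" using l by (simp add: \<delta>_def)
    show "\<delta> l = 0 \<Longrightarrow> l = 0" using l hK by (auto simp: \<delta>_def \<delta>A_def \<delta>B_def split: if_splits)
  next
    fix i assume i: "i \<le> h"
    then show "i < 2 * M \<and> \<delta> i = i" using hK by (simp add: \<delta>_def \<delta>A_def)
    show "(if i = 0 then 0 else M + (i - 1)) < 2 * M \<and> \<delta> (if i = 0 then 0 else M + (i - 1)) = i"
      using i hK by (auto simp: \<delta>_def \<delta>A_def \<delta>B_def)
  next
    fix i assume i: "i < h"
    then show "P (Suc i) = i" using hK by (simp add: P_def PA_def)
    show "P (if Suc i = 0 then 0 else M + (Suc i - 1)) = (if i = 0 then 0 else M + (i - 1))"
      using i by (simp add: P_def PB_def)
  next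
    show "1 \<noteq> (if 1 = (0::nat) then 0 else M + (1 - 1))" using K M by simp
  qed
qed

subsection \<open>The bound\<close>

text \<open>If \<open>d \<le> q + 1\<close>, then \<open>d * (2 ^ q + 1) < 2 ^ (q + 1)\<close>
  forces \<open>d = 1\<close>, hence \<open>m < 2\<close>.\<close>

lemma dimension_bound:
  fixes d m q :: nat
  assumes "d * m < 2 ^ d" "2 ^ q + 1 \<le> m" "0 < d"
  shows "q + 2 \<le> d"
proof (rule ccontr)
  assume "\<not> q + 2 \<le> d"
  then have "(2::nat) ^ d \<le> 2 ^ (q + 1)" by (intro power_increasing) auto
  moreover have "d * (2 ^ q + 1) \<le> d * m" using assms(2) by (rule mult_le_mono2)
  ultimately have "d * (2 ^ q + 1) < 2 * 2 ^ q" using assms(1) by simp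
  moreover have "2 * (2 ^ q + 1) \<le> d * (2 ^ q + 1)" if "2 \<le> d" using that by (rule mult_le_mono1)
  ultimately have "d = 1" using assms(3) by fastforce
  then have "m < 2" using assms(1) by simp
  moreover have "(1::nat) \<le> 2 ^ q" by simp
  ultimately show False using assms(2) by linarith
qed

text \<open>The last inequality bounds the average weight of a vertex by \<open>q + 2\<close>, with
  an extra \<open>1 / 2 ^ q\<close> for \<open>t > 0\<close>.\<close>

lemma tile_exists:
  fixes m q t d :: nat
  assumes m: "m = 2 ^ q + 1 + t" "t < 2 ^ q" and d: "d * m < 2 ^ d" "0 < d"
  shows "\<exists>r C D dep pt. r \<le> d \<and> rooted_tile r (m - 2) D dep pt \<and>
    (\<Sum>x\<in>cube r. tile_weight r dep pt x) \<le> C \<and>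
    2 ^ q * C \<le> (2 ^ q * (q + 2) + (if t = 0 then 0 else 1)) * 2 ^ r"
proof -
  have qd: "q + 2 \<le> d" using dimension_bound[of d m q] d m(1) by simp
  consider "q = 0" "t = 0" | "q = 1" "t = 0" | "q = 1" "t = 1" | "2 \<le> q" "t = 0" | "2 \<le> q" "0 < t"
    using m(2) by (cases "q = 0"; cases "q = 1"; cases "t = 0") auto
  then show ?thesis
  proof cases
    case 1
    then have "m - 2 = 0" using m by simp
    then show ?thesis using tile_2 1 by (intro exI[of _ 0] exI[of _ 2]) simp
  next
    case 2
    then have "m - 2 = 1" using m by simp
    then show ?thesis using tile_3 2 qd by (intro exI[of _ 3] exI[of _ 24]) simp
  next
    case 3
    then have "m = 4" using m by simp
    \<comment> \<open>\<open>d = 3\<close> would violate \<open>d * m < 2 ^ d\<close>, so the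
      four-dimensional tile fits.\<close>
    then have "m - 2 = 2" "d \<noteq> 3" using d by auto
    then have "4 \<le> d" using qd 3 by simp
    then show ?thesis using tile_4 3 \<open>m - 2 = 2\<close> by (intro exI[of _ 4] exI[of _ 56]) simp
  next
    case 4
    \<comment> \<open>Dimension \<open>q + 1\<close> leaves one unit per vertex for the root
      edge.\<close>
    then have "m - 2 = 2 ^ q - 1" using m by simp
    then show ?thesis using tile_cycle[OF 4(1)] 4 qd
      by (intro exI[of _ "Suc q"] exI[of _ "Suc q * 2 ^ Suc q + 2"]) (simp add: algebra_simps)
  next
    case 5
    \<comment> \<open>The inner edges use up \<open>q + 2\<close> per vertex, and the extra term
      pays for the root edge, which costs \<open>2 / 2 ^ (q + 2)\<close>.\<close>
    have "(1::nat) \<le> 2 ^ q" by simp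
    then have "m - 2 = 2 ^ q - 1 + t" using m by linarith
    then show ?thesis using tile_two_cycles[OF 5 m(2)] 5 qd
      by (intro exI[of _ "Suc (Suc q)"] exI[of _ "Suc (Suc q) * 2 ^ Suc (Suc q) + 2"])
        (simp add: algebra_simps)
  qed
qed

lemma sat_number_gstar_bound:
  fixes m q t d n :: nat
  assumes m: "m = 2 ^ q + 1 + t" "t < 2 ^ q"
    and d: "0 < d" "d < n" "m \<le> max_path_length d (hypercube d)"
  shows "2 ^ q * (2 * sat_number (hypercube n) (gstar (Suc d) m))
    \<le> 2 ^ (n - 1) * (2 ^ q * (d + q + 2) + (if t = 0 then 0 else 1))"
proof -
  let ?e = "if t = 0 then 0 else 1 :: nat"
  let ?S = "2 * sat_number (hypercube n) (gstar (Suc d) m)"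
  have "(1::nat) \<le> 2 ^ q" by simp
  then have m2: "m - 2 + 2 = m" using m by linarith
  obtain v L where L: "legs_from d d m v L" "v \<in> cube d"
    using max_path_length_legs[OF d(3,1)] by metis
  obtain r C D dep pt where r: "r \<le> d" and tile: "rooted_tile r (m - 2) D dep pt"
    and C: "(\<Sum>x\<in>cube r. tile_weight r dep pt x) \<le> C" "2 ^ q * C \<le> (2 ^ q * (q + 2) + ?e) * 2 ^ r"
    using tile_exists[OF m legs_card[OF L d(1)] d(1)] by (elim exE conjE)
  interpret rooted_tile r "m - 2" D dep pt by (rule tile)
  interpret saturating r "m - 2" D dep pt n d
  proof
    fix x assume "x \<in> cube n"
    then show "\<exists>L. legs_from d n (m - 2 + 2) x L"
      unfolding m2 using legs_translate[OF L] d(2) by simp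
  qed (use r d in auto)
  have "2 ^ r * ?S \<le> 2 ^ (n - 1) * (d * 2 ^ r + C)"
    using sat_number_weight[OF C(1)] unfolding m2 .
  then have "2 ^ q * (2 ^ r * ?S) \<le> 2 ^ q * (2 ^ (n - 1) * (d * 2 ^ r + C))" by (rule mult_le_mono2)
  also have "\<dots> = 2 ^ (n - 1) * (2 ^ q * d * 2 ^ r + 2 ^ q * C)" by (simp add: algebra_simps)
  also have "\<dots> \<le> 2 ^ (n - 1) * (2 ^ q * d * 2 ^ r + (2 ^ q * (q + 2) + ?e) * 2 ^ r)"
    using C(2) by (intro mult_le_mono2 add_left_mono)
  also have "\<dots> = 2 ^ r * (2 ^ (n - 1) * (2 ^ q * (d + q + 2) + ?e))"
    by (simp only: distrib_left distrib_right ac_simps)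
  finally have "2 ^ r * (2 ^ q * ?S) \<le> 2 ^ r * (2 ^ (n - 1) * (2 ^ q * (d + q + 2) + ?e))"
    by (simp only: ac_simps)
  then show ?thesis by simp
qed

theorem theorem5:
  fixes k m n :: nat and m' j :: int
  assumes "k \<ge> 1" and "m \<ge> 2"
    and "m' = \<lfloor>log 2 (real m - 1)\<rfloor>"
    and "j = \<lceil>log 2 (real m - 2 powi m')\<rceil>"
    and "m \<le> max_path_length (k - 1) (hypercube (k - 1))"
    and "n \<ge> k"
  shows "real (sat_number (hypercube n) (gstar k m))
         \<le> (real k + 1 + of_int m' + of_int j / 2 powi m') * 2 powi (int n - 2)"
proof -
  define d where "d = k - 1"
  \<comment> \<open>For \<open>k = 1\<close> the conventional value 0 of
    \<open>max_path_length\<close> contradicts \<open>m \<ge> 2\<close>.\<close>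
  have "d \<noteq> 0" using assms(2,5) by (auto simp: d_def max_path_length_def)
  then have d: "0 < d" "k = Suc d" "d < n" using assms(1,6) by (auto simp: d_def)
  obtain q where q: "2 ^ q \<le> m - 1" "m - 1 < 2 ^ (q + 1)"
  proof -
    have "1 \<le> m - 1" using assms(2) by linarith
    from ex_power_ivl1[OF order_refl this] that show thesis by blast
  qed
  define t where "t = m - 1 - 2 ^ q"
  have m: "m = 2 ^ q + 1 + t" "t < 2 ^ q" using q assms(2) by (auto simp: t_def)
  have m': "m' = int q"
    using floor_log_nat_eq_if[OF q] assms(2,3) by (simp add: of_nat_diff)
  have j': "j = \<lceil>log 2 (real t + 1)\<rceil>" using assms(4) by (simp add: m' m(1) algebra_simps)
  \<comment> \<open>As \<open>m - 2 ^ q = t + 1\<close>, \<open>j\<close> is 0 for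
    \<open>t = 0\<close> and at least 1 otherwise, so \<open>e\<close> is a lower bound for
    it.\<close>
  define e :: nat where "e = (if t = 0 then 0 else 1)"
  have e: "real e \<le> of_int j"
  proof (cases "t = 0")
    case False
    then have "0 < log 2 (real t + 1)" by simp
    then have "0 < j" by (simp add: j')
    then show ?thesis by (simp add: e_def)
  qed (simp add: e_def j')
  let ?S = "sat_number (hypercube n) (gstar k m)"
  have "2 ^ q * (2 * ?S) \<le> 2 ^ (n - 1) * (2 ^ q * (d + q + 2) + e)"
    using sat_number_gstar_bound[OF m d(1,3)] assms(5) d(2) by (simp add: e_def)
  then have "real (2 ^ q * (2 * ?S)) \<le> real (2 ^ (n - 1) * (2 ^ q * (d + q + 2) + e))"
    by (simp only: of_nat_le_iff)
  \<comment> \<open>From \<open>d \<ge> 1\<close> follows \<open>n \<ge> 2\<close>, so the integer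
    exponent is not negative.\<close>
  moreover have "(2::real) ^ (n - 1) = 2 * 2 powi (int n - 2)"
  proof -
    have "n - 1 = Suc (n - 2)" "int n - 2 = int (n - 2)" using d by auto
    then show ?thesis by (simp only: power_int_of_nat power_Suc)
  qed
  ultimately have "2 ^ q * (2 * real ?S) \<le> 2 * 2 powi (int n - 2) * (2 ^ q * (real d + real q + 2) + real e)"
    by (simp add: algebra_simps)
  then have "2 ^ q * real ?S \<le> 2 powi (int n - 2) * (2 ^ q * (real d + real q + 2) + real e)" by linarith
  also have "\<dots> \<le> 2 powi (int n - 2) * (2 ^ q * (real d + real q + 2) + of_int j)"
    using e by (intro mult_left_mono add_left_mono) auto
  finally have "real ?S \<le> 2 powi (int n - 2) * (2 ^ q * (real d + real q + 2) + of_int j) / 2 ^ q"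
    by (simp add: field_simps)
  also have "\<dots> = (real k + 1 + of_int m' + of_int j / 2 powi m') * 2 powi (int n - 2)"
    by (simp add: m' d(2) field_simps)
  finally show ?thesis .
qed

end
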